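(* Let $T\ge 0$ be a random time with density $p_T$, independent of a standard Brownian motion $B$, let $X_1,\dots,X_n$ be i.i.d. copies of $X=B_T$, and let $p_{T,n}$ be the estimator defined in the context, with parameter $\gamma$ and bandwidths $h_n>0$, $h_n\to0$. Assume that $p_T\in\mathcal{C}(\beta,\gamma,L)$ for some $\beta>0$, $L>0$ and that $$\max\bigl((a_T+1)/2,\,3/4\bigr)<\gamma<b_T .$$ Then for some constant $C_{\gamma,L}$ depending on $\gamma$ and $L$ only, $$\sup_{x\ge0}\mathbb{E}\Bigl[\bigl\{x^{\gamma}|p_T(x)-p_{T,n}(x)|\bigr\}^2\Bigr]\le C_{\gamma,L}\times\begin{cases} e^{-2\beta/h_n}+\frac1n h_n^{2(\gamma-1)}e^{\pi/h_n}, & \gamma<1,\\ e^{-2\beta/h_n}+\frac1n e^{\pi/h_n}, & \gamma\ge1.\end{cases}$$ Moreover, choosing $$h_n=\begin{cases}\dfrac{\pi+2\beta}{\log n-2(1-\gamma)\log\log n}, & \gamma<1,\\[2mm] (\pi+2\beta)/\log n, & \gamma\ge1,\end{cases}$$ one obtains, as $n\to\infty$, $$\sup_{x\ge0}\sqrt{\mathbb{E}\Bigl[\bigl\{x^{\gamma}|p_T(x)-p_{T,n}(x)|\bigr\}^2\Bigr]}\lesssim\begin{cases} n^{-\frac{\beta}{\pi+2\beta}}\log^{\frac{2(1-\gamma)\beta}{\pi+2\beta}}n, & \gamma<1,\\ n^{-\frac{\beta}{\pi+2\beta}}, & \gamma\ge1.\end{cases}$$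
   Context: For a non-negative random variable $\xi$ with density $p_\xi$, the Mellin transform is $\mathcal{M}[p_\xi](z)=\mathbb{E}[\xi^{z-1}]=\int_0^\infty p_\xi(x)x^{z-1}\,dx$ for $z\in\mathcal{S}_\xi=\{z\in\mathbb{C}:\mathbb{E}[\xi^{\mathrm{Re}\,z-1}]<\infty\}$. It is assumed that $0\le a_T<1\le b_T$ are such that $\{z: a_T<\mathrm{Re}(z)<b_T\}\subset\mathcal{S}_T$. For $\beta>0$, $\gamma>0$, $L>0$, $$\mathcal{C}(\beta,\gamma,L)=\Bigl\{f:\int_{-\infty}^\infty|\mathcal{M}[f](\gamma+\mathrm{i}v)|\,e^{\beta|v|}\,dv<L\Bigr\}.$$ The empirical Mellin transform is $\mathcal{M}_n[p_{|X|}](z)=\frac1n\sum_{k=1}^n|X_k|^{z-1}$, $\mathrm{Re}(z)>1/2$. With the kernel $K(y)=1_{[-1,1]}(y)$ and bandwidths $h_n>0$ tending to $0$, the estimator of $p_T$ is $$p_{T,n}(x)=\frac{1}{\sqrt\pi}\int_{-\infty}^\infty x^{-\gamma-\mathrm{i}v}K(vh_n)\frac{\mathcal{M}_n[p_{|X|}](2(\gamma+\mathrm{i}v)-1)}{2^{\gamma+\mathrm{i}v}\,\Gamma(\gamma-1/2+\mathrm{i}v)}\,dv .$$ $A\lesssim B$ means that $A$ is bounded by a constant multiple of $B$, independently of the parameters involved, i.e. $A=O(B)$.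
   Formalization: Added assumption: E[T^(2γ-2)] ≤ m, and the constants may depend on γ, L and m (a constant depending on γ and L only does not exist for γ<1, and for γ>1 the risk can be infinite); p_T is taken to be the version of the density continuous on (0,∞). *)

theory Defs
  imports "HOL-Probability.Probability"
begin

definition mellin :: "(real \<Rightarrow> real) \<Rightarrow> complex \<Rightarrow> complex" where
  "mellin f z =
     (LINT x:{0<..}|lborel. complex_of_real (f x) * complex_of_real x powr (z - 1))"

text \<open>
  The set \<open>S\<^sub>\<xi>\<close> of a non-negative random variable. Since \<open>0 powr a = 0\<close> here, it agrees with the
  usual convention for negative powers only if \<open>\<xi> > 0\<close> almost surely, for example if \<open>\<xi>\<close> has a
  density.
\<close>
definition mellin_domain :: "'a measure \<Rightarrow> ('a \<Rightarrow> real) \<Rightarrow> complex set" where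
  "mellin_domain M \<xi> = {z. (\<integral>\<^sup>+\<omega>. ennreal (\<xi> \<omega> powr (Re z - 1)) \<partial>M) < \<infinity>}"

text \<open>
  The first clause says that the Mellin transform is defined on the line \<open>Re z = \<gamma>\<close>; without it,
  a divergent Bochner integral would count as zero.
\<close>
definition mellin_class :: "real \<Rightarrow> real \<Rightarrow> real \<Rightarrow> (real \<Rightarrow> real) set" where
  "mellin_class \<beta> \<gamma> L =
     {f. (\<forall>v. set_integrable lborel {0<..}
                (\<lambda>x. complex_of_real (f x) * complex_of_real x powr (Complex \<gamma> v - 1))) \<and>
         (\<integral>\<^sup>+v. ennreal (cmod (mellin f (Complex \<gamma> v)) * exp (\<beta> * \<bar>v\<bar>)) \<partial>lborel) < ennreal L}"

definition brownian_motion :: "'a measure \<Rightarrow> (real \<Rightarrow> 'a \<Rightarrow> real) \<Rightarrow> bool" where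
  "brownian_motion M B \<longleftrightarrow>
     prob_space M \<and>
     (\<forall>t\<ge>0. B t \<in> borel_measurable M) \<and>
     (AE \<omega> in M. B 0 \<omega> = 0) \<and>
     (\<forall>s t. 0 \<le> s \<and> s < t \<longrightarrow>
        distributed M lborel (\<lambda>\<omega>. B t \<omega> - B s \<omega>) (\<lambda>x. ennreal (normal_density 0 (sqrt (t - s)) x))) \<and>
     (\<forall>(t :: nat \<Rightarrow> real) n. 0 \<le> t 0 \<and> mono t \<longrightarrow>
        prob_space.indep_vars M (\<lambda>_. borel) (\<lambda>i \<omega>. B (t (Suc i)) \<omega> - B (t i) \<omega>) {..<n}) \<and>
     (\<forall>\<omega>\<in>space M. continuous_on {0..} (\<lambda>t. B t \<omega>))"

text \<open>
  Independence of the time \<open>T\<close> and the whole process \<open>B\<close>. The constant \<open>prob_space.indep_var\<close>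
  cannot be used, as it wants both random elements to take values in the same type.
\<close>
definition indep_time_process :: "'a measure \<Rightarrow> ('a \<Rightarrow> real) \<Rightarrow> (real \<Rightarrow> 'a \<Rightarrow> real) \<Rightarrow> bool" where
  "indep_time_process M T B \<longleftrightarrow>
     prob_space.indep_set M
       {T -` A \<inter> space M | A. A \<in> sets borel}
       {(\<lambda>\<omega>. \<lambda>t\<in>{0..}. B t \<omega>) -` A \<inter> space M | A. A \<in> sets (\<Pi>\<^sub>M t\<in>{0..}. borel)}"

definition iid_copies ::
    "'b measure \<Rightarrow> (nat \<Rightarrow> 'b \<Rightarrow> real) \<Rightarrow> nat set \<Rightarrow> 'a measure \<Rightarrow> ('a \<Rightarrow> real) \<Rightarrow> bool" where
  "iid_copies P X I M Y \<longleftrightarrow>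
     prob_space P \<and> prob_space.indep_vars P (\<lambda>_. borel) X I \<and>
     (\<forall>k\<in>I. distr P borel (X k) = distr M borel Y)"

definition empirical_mellin :: "nat \<Rightarrow> (nat \<Rightarrow> real) \<Rightarrow> complex \<Rightarrow> complex" where
  "empirical_mellin n x z =
     1 / of_nat n * (\<Sum>k=1..n. complex_of_real \<bar>x k\<bar> powr (z - 1))"

definition kernel :: "real \<Rightarrow> real" where
  "kernel y = indicator {-1..1} y"

text \<open>
  The estimator for bandwidth \<open>h\<close> and sample \<open>xs 1, \<dots>, xs n\<close>. Its values are real, but
  have type \<open>complex\<close>.
\<close>
definition estimator :: "real \<Rightarrow> real \<Rightarrow> nat \<Rightarrow> (nat \<Rightarrow> real) \<Rightarrow> real \<Rightarrow> complex" where
  "estimator \<gamma> h n xs x =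
     1 / complex_of_real (sqrt pi) *
     (LINT v|lborel.
        complex_of_real x powr (- Complex \<gamma> v) * complex_of_real (kernel (v * h)) *
        (empirical_mellin n xs (2 * Complex \<gamma> v - 1) /
         (2 powr Complex \<gamma> v * Gamma (Complex (\<gamma> - 1/2) v))))"

text \<open>
  The expectation is taken in \<open>[0,\<infinity>]\<close>, so that a finite bound includes square integrability. At
  \<open>x = 0\<close> the weight \<open>x powr \<gamma>\<close> is \<open>0\<close>, and so is the risk.
\<close>
definition weighted_risk ::
    "'b measure \<Rightarrow> (nat \<Rightarrow> 'b \<Rightarrow> real) \<Rightarrow> nat \<Rightarrow> real \<Rightarrow> real \<Rightarrow> (real \<Rightarrow> real) \<Rightarrow> real \<Rightarrow> ennreal" where
  "weighted_risk P X n h \<gamma> p x =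
     (\<integral>\<^sup>+\<omega>. ennreal ((x powr \<gamma> *
        cmod (complex_of_real (p x) - estimator \<gamma> h n (\<lambda>k. X k \<omega>) x))\<^sup>2) \<partial>P)"

definition ennsqrt :: "ennreal \<Rightarrow> ennreal" where
  "ennsqrt r = (if r = \<infinity> then \<infinity> else ennreal (sqrt (enn2real r)))"

definition opt_bandwidth :: "real \<Rightarrow> real \<Rightarrow> nat \<Rightarrow> real" where
  "opt_bandwidth \<beta> \<gamma> n =
     (if \<gamma> < 1 then (pi + 2 * \<beta>) / (ln (real n) - 2 * (1 - \<gamma>) * ln (ln (real n)))
      else (pi + 2 * \<beta>) / ln (real n))"

end

theory Submission
  imports Defs
begin

text \<open>
  On the line \<open>Re z = \<gamma>\<close> the estimator is the Mellin inversion integral for the density of \<open>T\<close>,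
  truncated to \<open>\<bar>Im z\<bar> \<le> 1/h\<close>, in which the unknown transform is replaced by an empirical one.
  This works because \<open>X = B\<^sub>T\<close> has the law of \<open>sqrt T * Z\<close> with \<open>Z\<close> standard normal and independent of
  \<open>T\<close> (\<open>distr_brownian_random_time\<close>), so that \<open>\<bar>X\<bar> powr (2 * z - 2)\<close> has as its mean the product of
  the Mellin transform \<open>E (T powr (z - 1))\<close> and the known normal moment
  \<open>2 powr (z - 1) * Gamma (z - 1/2) / sqrt pi\<close> (\<open>moment_normal_scale_mixture\<close>). Dividing by the latter
  undoes the passage from \<open>T\<close> to \<open>X\<close>. By \<open>mellin_inversion\<close> the weighted error then splits into two
  parts (\<open>estimator_error_le\<close>).

  The bias is the part of the inversion integral beyond \<open>1/h\<close>. The exponential weight in the class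
  makes it at most a multiple of \<open>exp (- \<beta> / h)\<close>, uniformly in \<open>x\<close>, because the factor \<open>x powr \<gamma>\<close>
  cancels the modulus of \<open>x powr (- z)\<close>.

  The stochastic part is the integral over \<open>\<bar>v\<bar> \<le> 1/h\<close> of the centred empirical transform against
  \<open>1 / Gamma (\<gamma> - 1/2 + \<i> * v)\<close>. The variance of the empirical transform is at most \<open>K / n\<close> for every \<open>v\<close>,
  where \<open>K\<close> is the absolute moment of \<open>X\<close> of order \<open>4 * \<gamma> - 4\<close>
  (\<open>empirical_mellin_variance_le\<close>). Since \<open>\<gamma> > 3/4\<close>, this order exceeds \<open>- 1\<close>, and \<open>K\<close> is controlled by
  the bound on the moment of \<open>T\<close> of order \<open>2 * \<gamma> - 2\<close>. A weighted Cauchy-Schwarz inequality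
  (\<open>nn_integral_weighted_power2_le\<close>) bounds the second moment of the stochastic part by \<open>K / n\<close> times
  the square of the integral of \<open>1 / \<bar>Gamma\<bar>\<close>. The modulus of \<open>1 / Gamma\<close> grows like
  \<open>\<bar>v\<bar> powr (1 - \<gamma>) * exp (pi * \<bar>v\<bar> / 2)\<close>, and this is where the factor \<open>exp (pi / h)\<close> and, for
  \<open>\<gamma> < 1\<close>, the power of \<open>h\<close> come from. The growth is obtained without Stirling's formula: the Euler
  product shows that \<open>1 / \<bar>Gamma (x + \<i> * y)\<bar>\<close> is, up to the factor \<open>Gamma x\<close>, decreasing and
  log-convex in \<open>x\<close>, and at \<open>x = 1/2\<close> the reflection formula gives it exactly.

  The bandwidth \<open>opt_bandwidth\<close> makes both terms of the bound at most the square of the claimed rate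
  (\<open>opt_bandwidth_rate\<close>).
\<close>

section \<open>The reciprocal Gamma function on vertical lines\<close>

text \<open>
  By the Euler product, this is the product over \<open>k\<close> of \<open>sqrt (1 + (y / (x + k))\<^sup>2)\<close>. Dividing by the
  value at \<open>y = 0\<close> removes the powers of \<open>n\<close> from the Euler limit, and each factor that remains is
  monotone and log-convex in \<open>x\<close>.
\<close>
definition rGamma_ratio :: "real \<Rightarrow> real \<Rightarrow> real" where
  "rGamma_ratio y x = Gamma x * cmod (rGamma (Complex x y))"

lemma rGamma_ratio_nonneg: "x > 0 \<Longrightarrow> rGamma_ratio y x \<ge> 0"
  by (simp add: rGamma_ratio_def Gamma_real_nonneg)

lemma rGamma_ratio_LIMSEQ:
  assumes "x > 0"
  shows "(\<lambda>n. \<Prod>k=0..<n+1. cmod (Complex (x + real k) y) / (x + real k)) \<longlonglongrightarrow> rGamma_ratio y x"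
proof -
  have "(\<lambda>n. Gamma_series x n * cmod (rGamma_series (Complex x y) n)) \<longlonglongrightarrow> rGamma_ratio y x"
    unfolding rGamma_ratio_def by (intro tendsto_intros)
  moreover have "Gamma_series x n * cmod (rGamma_series (Complex x y) n) =
      (\<Prod>k=0..<n+1. cmod (Complex (x + real k) y) / (x + real k))" for n
  proof -
    have c: "Complex x y + of_nat k = Complex (x + real k) y" for k
      by (simp add: complex_eq_iff)
    have "Gamma_series x n * cmod (rGamma_series (Complex x y) n) =
        cmod (pochhammer (Complex x y) (n+1)) / pochhammer x (n+1)"
      by (simp add: Gamma_series_def rGamma_series_def norm_divide norm_mult)
    also have "\<dots> = (\<Prod>k=0..<n+1. cmod (Complex (x + real k) y)) / (\<Prod>k=0..<n+1. x + real k)"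
      by (simp only: pochhammer_prod prod_norm [symmetric] c of_nat_id)
    finally show ?thesis by (simp only: prod_dividef)
  qed
  ultimately show ?thesis by (simp only:)
qed

lemma rGamma_factor_eq:
  assumes "t > 0"
  shows "cmod (Complex t y) / t = exp (ln (t\<^sup>2 + y\<^sup>2) / 2 - ln t)"
proof -
  have "t\<^sup>2 + y\<^sup>2 > 0" using assms by (simp add: add_pos_nonneg)
  hence "sqrt (t\<^sup>2 + y\<^sup>2) = exp (ln (t\<^sup>2 + y\<^sup>2) / 2)"
    using assms by (simp add: powr_half_sqrt [symmetric] powr_def mult.commute)
  thus ?thesis using assms by (simp add: cmod_def exp_diff)
qed

text \<open>
  The derivative \<open>t / (t\<^sup>2 + y\<^sup>2) - 1 / t\<close> equals \<open>- y\<^sup>2 / (t * (t\<^sup>2 + y\<^sup>2))\<close>, which increases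
  with \<open>t\<close>.
\<close>
lemma convex_on_ln_rGamma_factor: "convex_on {0<..} (\<lambda>t::real. ln (t\<^sup>2 + y\<^sup>2) / 2 - ln t)"
proof (rule convex_on_realI[where f' = "\<lambda>t. - (y\<^sup>2 / (t * (t\<^sup>2 + y\<^sup>2)))"])
  fix t :: real assume t: "t \<in> {0<..}"
  hence p: "t\<^sup>2 + y\<^sup>2 > 0" by (simp add: add_pos_nonneg)
  have "2 * t / (t\<^sup>2 + y\<^sup>2) / 2 - 1 / t = - (y\<^sup>2 / (t * (t\<^sup>2 + y\<^sup>2)))"
    using t p by (simp add: divide_simps power2_eq_square)
  thus "((\<lambda>t. ln (t\<^sup>2 + y\<^sup>2) / 2 - ln t) has_real_derivative - (y\<^sup>2 / (t * (t\<^sup>2 + y\<^sup>2)))) (at t)"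
    using t p by (auto intro!: derivative_eq_intros simp: divide_simps; simp add: algebra_simps power2_eq_square)
next
  fix s t :: real assume st: "s \<in> {0<..}" "t \<in> {0<..}" "s \<le> t"
  have "s * (s\<^sup>2 + y\<^sup>2) \<le> t * (t\<^sup>2 + y\<^sup>2)"
    using st by (intro mult_mono add_mono power_mono order_refl) auto
  moreover have "s * (s\<^sup>2 + y\<^sup>2) > 0" using st by (simp add: add_pos_nonneg)
  ultimately show "- (y\<^sup>2 / (s * (s\<^sup>2 + y\<^sup>2))) \<le> - (y\<^sup>2 / (t * (t\<^sup>2 + y\<^sup>2)))"
    unfolding neg_le_iff_le by (intro divide_left_mono) auto
qed auto

lemma rGamma_ratio_antimono:
  assumes "0 < a" "a \<le> b"
  shows "rGamma_ratio y b \<le> rGamma_ratio y a"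
proof (rule LIMSEQ_le[OF rGamma_ratio_LIMSEQ rGamma_ratio_LIMSEQ])
  have "cmod (Complex t y) / t \<le> cmod (Complex s y) / s" if "0 < s" "s \<le> t" for s t
  proof -
    have e: "cmod (Complex r y) / r = sqrt (1 + (y / r)\<^sup>2)" if "r > 0" for r
    proof -
      have "1 + (y / r)\<^sup>2 = (r\<^sup>2 + y\<^sup>2) / r\<^sup>2"
        using that by (simp add: power_divide add_divide_distrib)
      thus ?thesis using that by (simp add: cmod_def real_sqrt_divide)
    qed
    have "(y / t)\<^sup>2 \<le> (y / s)\<^sup>2"
      unfolding power_divide using that by (intro divide_left_mono power_mono) auto
    thus ?thesis using that by (simp add: e)
  qed
  thus "\<exists>N. \<forall>n\<ge>N. (\<Prod>k=0..<n+1. cmod (Complex (b + real k) y) / (b + real k)) \<le>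
                     (\<Prod>k=0..<n+1. cmod (Complex (a + real k) y) / (a + real k))"
    using assms by (intro exI[of _ 0] allI impI prod_mono) auto
qed (use assms in auto)

text \<open>
  Each factor of the product is log-convex in \<open>x\<close> by \<open>convex_on_ln_rGamma_factor\<close>, and the inequality
  passes to products and limits.
\<close>
lemma rGamma_ratio_log_convex:
  assumes "a > 0" "b > 0" "0 \<le> \<theta>" "\<theta> \<le> 1"
  shows "rGamma_ratio y ((1 - \<theta>) * a + \<theta> * b) \<le>
           rGamma_ratio y a powr (1 - \<theta>) * rGamma_ratio y b powr \<theta>"
proof -
  define q where "q t = cmod (Complex t y) / t" for t
  have pos: "(1 - \<theta>) * a + \<theta> * b > 0"
    using assms by (cases "\<theta> = 0") (auto intro: add_nonneg_pos)
  have q_pos: "q t > 0" if "t > 0" for t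
    using that by (simp add: q_def rGamma_factor_eq)
  have *: "q ((1 - \<theta>) * a + \<theta> * b + k) \<le> q (a + k) powr (1 - \<theta>) * q (b + k) powr \<theta>"
    if "k \<ge> 0" for k
  proof -
    have "q ((1 - \<theta>) * a + \<theta> * b + k) = q ((1 - \<theta>) * (a + k) + \<theta> * (b + k))"
      by (simp add: algebra_simps)
    also have "\<dots> \<le> q (a + k) powr (1 - \<theta>) * q (b + k) powr \<theta>"
      using convex_onD[OF convex_on_ln_rGamma_factor[of y], of \<theta> "a + k" "b + k"] assms that pos
      by (simp add: q_def rGamma_factor_eq algebra_simps powr_def exp_add [symmetric])
    finally show ?thesis .
  qed
  have nz: "rGamma_ratio y t \<noteq> 0" if "t > 0" for t
  proof -
    have "rGamma (Complex t y) \<noteq> 0"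
      using that by (subst rGamma_eq_zero_iff) (auto elim!: nonpos_Ints_cases simp: complex_eq_iff)
    moreover have "Gamma t > 0" using that by (rule Gamma_real_pos)
    ultimately show ?thesis by (simp add: rGamma_ratio_def)
  qed
  have "(\<lambda>n. (\<Prod>k=0..<n+1. q (a + real k)) powr (1 - \<theta>) * (\<Prod>k=0..<n+1. q (b + real k)) powr \<theta>)
      \<longlonglongrightarrow> rGamma_ratio y a powr (1 - \<theta>) * rGamma_ratio y b powr \<theta>"
    unfolding q_def using assms by (intro tendsto_mult tendsto_powr tendsto_const rGamma_ratio_LIMSEQ nz)
  moreover have "(\<lambda>n. \<Prod>k=0..<n+1. q ((1 - \<theta>) * a + \<theta> * b + real k))
      \<longlonglongrightarrow> rGamma_ratio y ((1 - \<theta>) * a + \<theta> * b)"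
    unfolding q_def by (intro rGamma_ratio_LIMSEQ pos)
  moreover have "(\<Prod>k=0..<n. q ((1 - \<theta>) * a + \<theta> * b + real k)) \<le>
    (\<Prod>k=0..<n. q (a + real k)) powr (1 - \<theta>) * (\<Prod>k=0..<n. q (b + real k)) powr \<theta>" for n
  proof -
    have "(\<Prod>k=0..<n. q ((1 - \<theta>) * a + \<theta> * b + real k)) \<le>
          (\<Prod>k=0..<n. q (a + real k) powr (1 - \<theta>) * q (b + real k) powr \<theta>)"
      using pos by (intro prod_mono conjI * less_imp_le[OF q_pos]) auto
    thus ?thesis
      using assms by (simp add: prod.distrib prod_powr_distrib less_imp_le[OF q_pos])
  qed
  ultimately show ?thesis
    by (intro LIMSEQ_le) blast+
qed

text \<open>
  For \<open>Re z = 1/2\<close> the reflected point \<open>1 - z\<close> is the conjugate of \<open>z\<close>, so the reflection formula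
  is a formula for the modulus.
\<close>
lemma norm_rGamma_half: "(cmod (rGamma (Complex (1/2) y)))\<^sup>2 = cosh (pi * y) / pi"
proof -
  define z where "z = Complex (1/2) y"
  have 1: "1 - z = cnj z" by (simp add: z_def complex_eq_iff)
  have 2: "sin (of_real pi * z) = complex_of_real (cosh (pi * y))"
  proof (rule complex_eqI)
    show "Re (sin (of_real pi * z)) = Re (complex_of_real (cosh (pi * y)))"
      by (simp add: z_def Re_sin cosh_def)
    show "Im (sin (of_real pi * z)) = Im (complex_of_real (cosh (pi * y)))"
      by (simp add: z_def Im_sin)
  qed
  have "rGamma z * cnj (rGamma z) = rGamma z * rGamma (1 - z)"
    by (simp only: 1 cnj_rGamma)
  also have "\<dots> = sin (of_real pi * z) / of_real pi" by (rule rGamma_reflection_complex)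
  also have "\<dots> = of_real (cosh (pi * y) / pi)" by (simp add: 2)
  finally have "complex_of_real ((cmod (rGamma z))\<^sup>2) = of_real (cosh (pi * y) / pi)"
    by (simp only: complex_norm_square)
  thus ?thesis by (simp only: of_real_eq_iff z_def)
qed

lemma rGamma_ratio_half: "rGamma_ratio y (1/2) \<le> exp (pi * \<bar>y\<bar> / 2)"
proof -
  have "(rGamma_ratio y (1/2))\<^sup>2 = cosh (pi * y)"
    by (simp add: rGamma_ratio_def power_mult_distrib norm_rGamma_half Gamma_one_half_real)
  also have "\<dots> = cosh (pi * \<bar>y\<bar>)" by (auto simp: abs_if)
  also have "\<dots> \<le> exp (pi * \<bar>y\<bar>)"
    by (simp add: cosh_def)
  also have "\<dots> = (exp (pi * \<bar>y\<bar> / 2))\<^sup>2" by (simp add: exp_double [symmetric])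
  finally show ?thesis by (rule power2_le_imp_le) simp
qed

text \<open>
  Monotonicity reduces this to the abscissa \<open>1/2\<close>.
\<close>
lemma norm_rGamma_le_right:
  assumes "x \<ge> 1/2"
  shows "cmod (rGamma (Complex x y)) \<le> exp (pi * \<bar>y\<bar> / 2) / Gamma x"
proof -
  have "rGamma_ratio y x \<le> rGamma_ratio y (1/2)" using assms by (intro rGamma_ratio_antimono) auto
  also note rGamma_ratio_half
  finally show ?thesis using assms by (simp add: rGamma_ratio_def field_simps Gamma_real_pos)
qed

text \<open>
  The shift \<open>rGamma z = z * rGamma (z + 1)\<close> moves the abscissa to \<open>x + 1\<close>, which lies between \<open>1/2\<close>
  and \<open>3/2\<close>. The values at the two ends differ by the factor \<open>\<bar>1/2 + \<i> * y\<bar>\<close>, so interpolation by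
  log-convexity yields the exact power of \<open>\<bar>y\<bar>\<close>.
\<close>
lemma norm_rGamma_le_left:
  assumes "0 < x" "x < 1/2"
  shows "cmod (rGamma (Complex x y)) \<le>
           (1 + 4 * y\<^sup>2) powr ((1/2 - x) / 2) * exp (pi * \<bar>y\<bar> / 2) / Gamma (x + 1)"
proof -
  define E where "E = exp (pi * \<bar>y\<bar> / 2)"
  define s where "s = 1 + 4 * y\<^sup>2"
  \<comment> \<open>the weight with \<open>x + 1 = (1 - \<theta>) * (1/2) + \<theta> * (3/2)\<close>\<close>
  define \<theta> where "\<theta> = x + 1/2"
  have s: "s > 0" by (simp add: s_def add_pos_nonneg)
  have half: "cmod (Complex (1/2) y) = s powr (1/2) / 2"
  proof -
    have "cmod (Complex (1/2) y) = sqrt (s / 2\<^sup>2)" by (simp add: cmod_def s_def field_simps)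
    thus ?thesis using s by (simp add: powr_half_sqrt real_sqrt_divide)
  qed
  have "rGamma (Complex (1/2) y) = Complex (1/2) y * rGamma (Complex (3/2) y)"
    using rGamma_plus1[of "Complex (1/2) y"] by (simp add: complex_eq_iff plus_complex.code one_complex.code)
  hence "rGamma_ratio y (1/2) = Gamma (1/2) * (s powr (1/2) / 2 * cmod (rGamma (Complex (3/2) y)))"
    by (simp add: rGamma_ratio_def norm_mult half)
  moreover have "(1/2 :: real) \<notin> \<int>\<^sub>\<le>\<^sub>0"
    using nonpos_Ints_nonpos by fastforce
  hence "Gamma (3/2) = 1/2 * Gamma (1/2 :: real)"
    using Gamma_plus1[of "1/2 :: real"] by simp
  ultimately have "rGamma_ratio y (1/2) = s powr (1/2) * rGamma_ratio y (3/2)"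
    unfolding rGamma_ratio_def by (simp only:) simp
  hence r: "rGamma_ratio y (3/2) = s powr (- (1/2)) * rGamma_ratio y (1/2)"
    using s by (simp flip: powr_add mult.assoc)
  have "rGamma_ratio y (x + 1) \<le> rGamma_ratio y (1/2) powr (1 - \<theta>) * rGamma_ratio y (3/2) powr \<theta>"
  proof -
    have "(1 - \<theta>) * (1/2) + \<theta> * (3/2) = x + 1" by (simp add: \<theta>_def field_simps)
    thus ?thesis
      using rGamma_ratio_log_convex[of "1/2" "3/2" \<theta> y] assms by (simp add: \<theta>_def)
  qed
  also have "\<dots> = rGamma_ratio y (1/2) * s powr (- \<theta> / 2)"
  proof -
    define R where "R = rGamma_ratio y (1/2)"
    have "(s powr (- (1/2)) * R) powr \<theta> = s powr (- \<theta> / 2) * R powr \<theta>"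
      using s by (simp add: powr_mult powr_powr)
    moreover have "R powr (1 - \<theta>) * R powr \<theta> = R"
      using R_def rGamma_ratio_nonneg[of "1/2" y] by (simp flip: powr_add)
    ultimately show ?thesis unfolding r R_def[symmetric] by (simp add: mult_ac)
  qed
  also have "\<dots> \<le> E * s powr (- \<theta> / 2)"
    unfolding E_def by (intro mult_right_mono rGamma_ratio_half) auto
  finally have 1: "cmod (rGamma (Complex (x + 1) y)) \<le> E * s powr (- \<theta> / 2) / Gamma (x + 1)"
    using assms by (simp add: rGamma_ratio_def pos_le_divide_eq Gamma_real_pos mult.commute)
  have "cmod (Complex x y) \<le> cmod (Complex (1/2) y)"
    using assms by (simp add: cmod_def power_mono)
  also have "\<dots> \<le> s powr (1/2)" by (simp add: half)
  finally have 2: "cmod (Complex x y) \<le> s powr (1/2)" .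
  have "rGamma (Complex x y) = Complex x y * rGamma (Complex (x + 1) y)"
    using rGamma_plus1[of "Complex x y"] by (simp add: plus_complex.code one_complex.code)
  hence "cmod (rGamma (Complex x y)) = cmod (Complex x y) * cmod (rGamma (Complex (x + 1) y))"
    by (simp add: norm_mult)
  also have "\<dots> \<le> s powr (1/2) * (E * s powr (- \<theta> / 2) / Gamma (x + 1))"
    using 1 2 by (intro mult_mono) auto
  also have "\<dots> = s powr ((1/2 - x) / 2) * E / Gamma (x + 1)"
  proof -
    have "s powr (1/2) * s powr (- \<theta> / 2) = s powr ((1/2 - x) / 2)"
      by (simp add: \<theta>_def field_simps flip: powr_add)
    thus ?thesis by (simp add: mult_ac)
  qed
  finally show ?thesis by (simp add: s_def E_def)
qed

section \<open>Absolute moments of the normal distribution\<close>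

lemma of_real_powr_complex_eq_exp:
  "x > 0 \<Longrightarrow> complex_of_real x powr z = exp (z * of_real (ln x))"
  by (simp add: powr_def Ln_of_real)

lemma norm_of_real_powr_complex: "x \<ge> 0 \<Longrightarrow> cmod (complex_of_real x powr z) = x powr Re z"
  by (cases "x = 0") (simp_all add: norm_powr_real_powr)

lemma measurable_of_real_powr [measurable]:
  assumes [measurable]: "f \<in> borel_measurable M" "g \<in> borel_measurable M"
  shows "(\<lambda>x. complex_of_real \<bar>f x\<bar> powr g x) \<in> borel_measurable M"
proof -
  have "complex_of_real \<bar>f x\<bar> powr g x = (if f x = 0 then 0 else exp (g x * of_real (ln \<bar>f x\<bar>)))" for x
    by (simp add: of_real_powr_complex_eq_exp)
  thus ?thesis by simp
qed

text \<open>
  The substitution \<open>t = x\<^sup>2 / 2\<close> in the Gamma integral.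
\<close>
lemma Gamma_integral_square_substitution:
  assumes z: "Re z > 1/2"
  defines "f \<equiv> \<lambda>x. complex_of_real \<bar>x\<bar> powr (2 * z - 2) * of_real (exp (- x\<^sup>2 / 2))"
  shows "set_integrable lborel {0<..} f"
    and "(LINT x:{0<..}|lborel. f x) = 2 powr (z - 3/2) * Gamma (z - 1/2)"
proof -
  define F where "F t = complex_of_real t powr ((z - 1/2) - 1) / of_real (exp t)" for t
  \<comment> \<open>the constant in \<open>x * (x\<^sup>2 / 2) powr (z - 3/2) = c * x powr (2 * z - 2)\<close>\<close>
  define c where "c = (2::complex) powr (3/2 - z)"
  have c0: "c \<noteq> 0" by (simp add: c_def powr_def)
  have z': "Re (z - 1/2) > 0" using z by simp
  have img: "(\<lambda>x::real. x\<^sup>2 / 2) ` {0<..} = {0<..}"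
  proof (intro set_eqI iffI)
    fix t :: real assume "t \<in> {0<..}"
    thus "t \<in> (\<lambda>x. x\<^sup>2 / 2) ` {0<..}" by (intro image_eqI[of _ _ "sqrt (2 * t)"]) auto
  qed auto
  have eq: "\<bar>x\<bar> *\<^sub>R F (x\<^sup>2 / 2) = c * f x" if "x \<in> {0<..}" for x
  proof -
    have x: "x > 0" using that by simp
    have "complex_of_real x * complex_of_real (x\<^sup>2 / 2) powr (z - 3/2) = c * of_real x powr (2 * z - 2)"
    proof -
      have l: "ln (x\<^sup>2 / 2) = 2 * ln x - ln 2" using x by (simp add: ln_div ln_realpow)
      have "complex_of_real x * complex_of_real (x\<^sup>2 / 2) powr (z - 3/2) =
          exp (of_real (ln x)) * exp ((z - 3/2) * of_real (2 * ln x - ln 2))"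
        using x by (subst of_real_powr_complex_eq_exp) (auto simp: l exp_of_real)
      also have "\<dots> = exp ((3/2 - z) * of_real (ln 2)) * exp ((2 * z - 2) * of_real (ln x))"
        by (simp add: exp_add [symmetric] algebra_simps)
      also have "exp ((3/2 - z) * of_real (ln 2)) = c"
        using of_real_powr_complex_eq_exp[of 2] by (simp add: c_def)
      also have "exp ((2 * z - 2) * of_real (ln x)) = of_real x powr (2 * z - 2)"
        using x by (simp add: of_real_powr_complex_eq_exp)
      finally show ?thesis .
    qed
    thus ?thesis using x
      by (simp add: F_def f_def scaleR_conv_of_real exp_minus field_simps)
  qed
  have "F absolutely_integrable_on {0<..}" "(F has_integral Gamma (z - 1/2)) {0<..}"
    unfolding F_def using absolutely_integrable_Gamma_integral'[OF z'] Gamma_integral_complex'[OF z'] .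
  hence "F absolutely_integrable_on (\<lambda>x::real. x\<^sup>2 / 2) ` {0<..} \<and>
         integral ((\<lambda>x::real. x\<^sup>2 / 2) ` {0<..}) F = Gamma (z - 1/2)"
    by (simp add: img integral_unique)
  hence "(\<lambda>x. \<bar>x\<bar> *\<^sub>R F (x\<^sup>2 / 2)) absolutely_integrable_on {0<..} \<and>
         integral {0<..} (\<lambda>x. \<bar>x\<bar> *\<^sub>R F (x\<^sup>2 / 2)) = Gamma (z - 1/2)"
    by (subst has_absolute_integral_change_of_variables_real)
       (auto intro!: derivative_eq_intros inj_onI)
  moreover have "(\<lambda>x. \<bar>x\<bar> *\<^sub>R F (x\<^sup>2 / 2)) absolutely_integrable_on {0<..} \<longleftrightarrow>
      (\<lambda>x. c * f x) absolutely_integrable_on {0<..}"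
    by (intro set_integrable_cong refl eq)
  moreover have "integral {0<..} (\<lambda>x. \<bar>x\<bar> *\<^sub>R F (x\<^sup>2 / 2)) = integral {0<..} (\<lambda>x. c * f x)"
    by (intro Henstock_Kurzweil_Integration.integral_cong eq)
  ultimately have ai: "(\<lambda>x. c * f x) absolutely_integrable_on {0<..}"
    and i: "integral {0<..} (\<lambda>x. c * f x) = Gamma (z - 1/2)"
    by simp_all
  have "(\<lambda>x. inverse c * (c * f x)) absolutely_integrable_on {0<..}"
    by (intro set_integrable_mult_right ai)
  hence "set_integrable lebesgue {0<..} f" using c0 by simp
  have [measurable]: "f \<in> borel_measurable borel" unfolding f_def by measurable
  show int: "set_integrable lborel {0<..} f"
    using \<open>set_integrable lebesgue {0<..} f\<close> unfolding set_integrable_def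
    by (subst (asm) integrable_completion) auto
  have "(LINT x:{0<..}|lborel. f x) = (LINT x:{0<..}|lebesgue. f x)"
    unfolding set_lebesgue_integral_def by (subst integral_completion) auto
  also have "\<dots> = integral {0<..} f"
    using \<open>set_integrable lebesgue {0<..} f\<close> by (rule set_lebesgue_integral_eq_integral)
  also have "c * \<dots> = Gamma (z - 1/2)"
    using i by simp
  hence "integral {0<..} f = Gamma (z - 1/2) / c" using c0 by (simp add: field_simps)
  also have "\<dots> = 2 powr (z - 3/2) * Gamma (z - 1/2)"
  proof -
    have "inverse c = 2 powr (z - 3/2)"
      using powr_minus[of "2::complex" "3/2 - z"] unfolding c_def minus_diff_eq by (rule sym)
    thus ?thesis by (simp only: divide_inverse mult.commute)
  qed
  finally show "(LINT x:{0<..}|lborel. f x) = 2 powr (z - 3/2) * Gamma (z - 1/2)" .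
qed

text \<open>
  The integrand is even, so the integral is twice that over the positive half-line.
\<close>
lemma std_normal_abs_powr_moment:
  assumes z: "Re z > 1/2"
  shows "integrable std_normal_distribution (\<lambda>x. complex_of_real \<bar>x\<bar> powr (2 * z - 2))"
    and "(LINT x|std_normal_distribution. complex_of_real \<bar>x\<bar> powr (2 * z - 2)) =
           2 powr (z - 1) * Gamma (z - 1/2) / of_real (sqrt pi)"
proof -
  define f where "f x = complex_of_real \<bar>x\<bar> powr (2 * z - 2) * of_real (exp (- x\<^sup>2 / 2))" for x
  define k where "k = 1 / sqrt (2 * pi)"
  \<comment> \<open>\<open>g\<close> is \<open>f\<close> on the positive half-line, and \<open>f x = g x + g (- x)\<close> everywhere, as \<open>f 0 = 0\<close>\<close>
  have f_even: "f (- x) = f x" and f0: "f 0 = 0" for x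
    by (simp_all add: f_def)
  define g where "g x = indicator {0<..} x *\<^sub>R f x" for x
  have int: "integrable lborel g" "integral\<^sup>L lborel g = 2 powr (z - 3/2) * Gamma (z - 1/2)"
    using Gamma_integral_square_substitution[OF z]
    unfolding g_def f_def set_integrable_def set_lebesgue_integral_def by auto
  have int': "integrable lborel (\<lambda>x. g (- x))" "integral\<^sup>L lborel (\<lambda>x. g (- x)) = integral\<^sup>L lborel g"
    using lborel_integrable_real_affine[OF int(1), of "-1" 0] lborel_integral_real_affine[of "-1" g 0]
    by auto
  have f_eq: "f = (\<lambda>x. g x + g (- x))"
    using f_even f0 by (auto simp: g_def fun_eq_iff indicator_def less_le)
  have fint: "integrable lborel f" "integral\<^sup>L lborel f = 2 * (2 powr (z - 3/2) * Gamma (z - 1/2))"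
    unfolding f_eq using int int' by simp_all
  have eq: "std_normal_density x *\<^sub>R complex_of_real \<bar>x\<bar> powr (2 * z - 2) = k *\<^sub>R f x" for x
    by (simp add: std_normal_density_def f_def k_def scaleR_conv_of_real)
  show "integrable std_normal_distribution (\<lambda>x. complex_of_real \<bar>x\<bar> powr (2 * z - 2))"
    by (subst integrable_density) (auto simp: eq intro: fint)
  have two: "2 * (2::complex) powr (z - 3/2) = 2 powr (z - 1) * of_real (sqrt 2)"
  proof -
    have "complex_of_real (sqrt 2) = of_real (2 powr (1/2))" by (simp add: powr_half_sqrt)
    also have "\<dots> = 2 powr (1/2)" using powr_of_real[of 2 "1/2"] by simp
    finally show ?thesis using powr_add[of "2::complex" 1 "z - 3/2"] powr_add[of "2::complex" "z - 1" "1/2"]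
      by (simp add: algebra_simps)
  qed
  have "k * sqrt 2 = 1 / sqrt pi" by (simp add: k_def real_sqrt_mult)
  hence k: "complex_of_real k * of_real (sqrt 2) = 1 / of_real (sqrt pi)"
    unfolding of_real_mult[symmetric] by (simp only: of_real_divide of_real_1)
  have "(LINT x|std_normal_distribution. complex_of_real \<bar>x\<bar> powr (2 * z - 2)) =
      k *\<^sub>R (2 * (2 powr (z - 3/2) * Gamma (z - 1/2)))"
    by (subst integral_density) (auto simp: eq fint)
  also have "\<dots> = of_real k * (2 * 2 powr (z - 3/2)) * Gamma (z - 1/2)"
    by (simp add: scaleR_conv_of_real)
  also have "\<dots> = (of_real k * of_real (sqrt 2)) * (2 powr (z - 1) * Gamma (z - 1/2))"
    unfolding two by (simp only: mult_ac)
  also have "\<dots> = 2 powr (z - 1) * Gamma (z - 1/2) / of_real (sqrt pi)"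
    unfolding k by simp
  finally show "(LINT x|std_normal_distribution. complex_of_real \<bar>x\<bar> powr (2 * z - 2)) =
      2 powr (z - 1) * Gamma (z - 1/2) / of_real (sqrt pi)" .
qed

section \<open>Brownian motion at an independent time\<close>

text \<open>
  Evaluation at a fixed time is measurable on the product space, hence the events of \<open>B t\<close> are among
  those of the process.
\<close>
lemma (in prob_space) indep_var_time_brownian:
  assumes ind: "indep_time_process M T B" and t: "t \<ge> 0"
    and [measurable]: "random_variable borel T" "random_variable borel (B t)"
  shows "indep_var borel T borel (B t)"
proof -
  define \<A> where "\<A> = {T -` A \<inter> space M | A. A \<in> sets borel}"
  define \<B> where "\<B> = {B t -` A \<inter> space M | A. A \<in> sets borel}"
  define W where "W \<omega> = (\<lambda>t\<in>{0..}. B t \<omega>)" for \<omega>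
  define \<P> where "\<P> = {W -` A \<inter> space M | A. A \<in> sets (\<Pi>\<^sub>M t\<in>{0::real..}. (borel :: real measure))}"
  have ind': "indep_set \<A> \<P>"
    using ind unfolding indep_time_process_def \<A>_def \<P>_def W_def .
  have "\<B> \<subseteq> \<P>"
  proof
    fix b assume "b \<in> \<B>"
    then obtain A where A: "A \<in> sets borel" "b = B t -` A \<inter> space M" by (auto simp: \<B>_def)
    define C where "C = (\<lambda>w. w t) -` A \<inter> space (\<Pi>\<^sub>M t\<in>{0::real..}. (borel :: real measure))"
    have "C \<in> sets (\<Pi>\<^sub>M t\<in>{0::real..}. (borel :: real measure))"
      unfolding C_def using A(1) t by (intro measurable_sets[OF measurable_component_singleton]) auto
    moreover have "b = W -` C \<inter> space M"
      using t by (auto simp: A(2) C_def W_def space_PiM)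
    ultimately show "b \<in> \<P>" unfolding \<P>_def by blast
  qed
  hence "indep_set \<A> \<B>"
    using ind' unfolding indep_sets2_eq by blast
  moreover have "Int_stable {X -` A \<inter> space M | A. A \<in> sets borel}" for X :: "'a \<Rightarrow> real"
  proof (rule Int_stableI)
    fix a b assume "a \<in> {X -` A \<inter> space M | A. A \<in> sets borel}" "b \<in> {X -` A \<inter> space M | A. A \<in> sets borel}"
    then obtain A B where "A \<in> sets borel" "B \<in> sets borel" "a = X -` A \<inter> space M" "b = X -` B \<inter> space M"
      by auto
    thus "a \<inter> b \<in> {X -` A \<inter> space M | A. A \<in> sets borel}"
      by (intro CollectI exI[of _ "A \<inter> B"]) auto
  qed
  ultimately have "indep_set (sigma_sets (space M) \<A>) (sigma_sets (space M) \<B>)"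
    unfolding \<A>_def \<B>_def by (intro indep_set_sigma_sets)
  thus ?thesis unfolding indep_var_eq \<A>_def \<B>_def by simp
qed

lemma brownian_motion_char:
  assumes bm: "brownian_motion M B" and t: "t \<ge> 0"
  shows "(LINT \<omega>|M. iexp (u * B t \<omega>)) = of_real (exp (- (u\<^sup>2 * t / 2)))"
proof -
  interpret prob_space M using bm by (simp add: brownian_motion_def)
  have [measurable]: "B t \<in> borel_measurable M" "B 0 \<in> borel_measurable M"
    using bm t by (auto simp: brownian_motion_def)
  have B0: "AE \<omega> in M. B 0 \<omega> = 0" using bm by (simp add: brownian_motion_def)
  show ?thesis
  proof (cases "t = 0")
    case True
    have "(LINT \<omega>|M. iexp (u * B t \<omega>)) = (LINT \<omega>|M. 1)"
      by (intro integral_cong_AE) (use B0 True in auto)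
    thus ?thesis using True by (simp add: prob_space)
  next
    case False
    hence t: "t > 0" using t by simp
    define W where "W \<omega> = (B t \<omega> - B 0 \<omega> - 0) / sqrt t" for \<omega>
    have [measurable]: "W \<in> borel_measurable M" unfolding W_def by measurable
    have "distributed M lborel (\<lambda>\<omega>. B t \<omega> - B 0 \<omega>) (normal_density 0 (sqrt (t - 0)))"
      using bm t unfolding brownian_motion_def by blast
    hence "distributed M lborel W std_normal_density"
      unfolding W_def using t by (subst (asm) normal_standard_normal_convert) auto
    hence W: "distr M lborel W = std_normal_distribution"
      by (rule distributed_distr_eq_density)
    have "(LINT \<omega>|M. iexp (u * B t \<omega>)) = (LINT \<omega>|M. iexp ((u * sqrt t) * W \<omega>))"
      by (intro integral_cong_AE) (use B0 t in \<open>auto simp: W_def\<close>)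
    also have "\<dots> = (LINT x|distr M lborel W. iexp ((u * sqrt t) * x))"
      by (subst integral_distr) auto
    also have "\<dots> = char std_normal_distribution (u * sqrt t)"
      by (simp add: W char_def)
    also have "\<dots> = of_real (exp (- (u\<^sup>2 * t / 2)))"
      using t by (simp add: char_std_normal_distribution power_mult_distrib)
    finally show ?thesis .
  qed
qed

text \<open>
  Rounds \<open>t\<close> down to the grid of mesh \<open>1 / (k + 1)\<close>. The cap at \<open>k + 1\<close> leaves only finitely many
  values, so that expectations of functions of the rounded time are finite sums; it tends to infinity
  and does not affect the limit.
\<close>
definition grid_index :: "nat \<Rightarrow> real \<Rightarrow> nat" where
  "grid_index k t = min (nat \<lfloor>real (Suc k) * t\<rfloor>) ((Suc k)\<^sup>2)"

lemma grid_index_LIMSEQ: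
  assumes "t \<ge> 0"
  shows "(\<lambda>k. real (grid_index k t) / real (Suc k)) \<longlonglongrightarrow> t"
proof (rule LIMSEQ_I)
  fix e :: real assume "e > 0"
  \<comment> \<open>beyond \<open>K1\<close> the cap is inactive, beyond \<open>K2\<close> the mesh is below \<open>e\<close>\<close>
  obtain K1 where K1: "real K1 > t" using reals_Archimedean2 by blast
  obtain K2 where K2: "inverse (real (Suc K2)) < e" using reals_Archimedean \<open>e > 0\<close> by blast
  show "\<exists>K. \<forall>k\<ge>K. norm (real (grid_index k t) / real (Suc k) - t) < e"
  proof (intro exI allI impI)
    fix k assume k: "k \<ge> max K1 K2"
    have "real (Suc k) * t \<le> real (Suc k) * real (Suc k)"
      using k K1 by (intro mult_left_mono) auto
    hence "real (Suc k) * t \<le> of_int (int ((Suc k)\<^sup>2))"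
      by (simp only: of_int_of_nat_eq of_nat_mult of_int_mult power2_eq_square)
    from floor_mono[OF this] have "\<lfloor>real (Suc k) * t\<rfloor> \<le> int ((Suc k)\<^sup>2)"
      by (simp only: floor_of_int)
    hence "grid_index k t = nat \<lfloor>real (Suc k) * t\<rfloor>"
      unfolding grid_index_def by linarith
    moreover have "0 \<le> \<lfloor>real (Suc k) * t\<rfloor>" using assms by simp
    ultimately have d: "real (grid_index k t) = of_int \<lfloor>real (Suc k) * t\<rfloor>" by simp
    have "\<bar>real (grid_index k t) - real (Suc k) * t\<bar> \<le> 1"
      unfolding d by linarith
    have "\<bar>real (grid_index k t) / real (Suc k) - t\<bar> = \<bar>real (grid_index k t) - real (Suc k) * t\<bar> / real (Suc k)"
    proof -
      have "real (grid_index k t) / real (Suc k) - t = (real (grid_index k t) - real (Suc k) * t) / real (Suc k)"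
        by (simp add: diff_divide_distrib del: of_nat_Suc)
      thus ?thesis by (simp add: abs_divide del: of_nat_Suc)
    qed
    also have "\<dots> \<le> 1 / real (Suc k)"
      by (intro divide_right_mono) (fact, simp)
    also have "\<dots> \<le> inverse (real (Suc K2))"
      using k by (simp add: inverse_eq_divide frac_le)
    also note K2
    finally show "norm (real (grid_index k t) / real (Suc k) - t) < e" by simp
  qed
qed

context
  fixes M :: "'a measure" and B :: "real \<Rightarrow> 'a \<Rightarrow> real" and T :: "'a \<Rightarrow> real"
  assumes bm: "brownian_motion M B"
    and T_nonneg: "\<And>\<omega>. \<omega> \<in> space M \<Longrightarrow> 0 \<le> T \<omega>"
    and ind: "indep_time_process M T B"
    and T_meas [measurable]: "T \<in> borel_measurable M"
begin

interpretation prob_space M using bm by (simp add: brownian_motion_def)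

lemma brownian_random_time_sum:
  fixes f :: "real \<Rightarrow> 'a \<Rightarrow> 'c :: real_vector"
  shows "f (real (grid_index k (T \<omega>)) / real (Suc k)) \<omega> =
    (\<Sum>j\<le>(Suc k)\<^sup>2. indicator {\<omega>. grid_index k (T \<omega>) = j} \<omega> *\<^sub>R f (real j / real (Suc k)) \<omega>)"
proof -
  have "(\<Sum>j\<le>(Suc k)\<^sup>2. indicator {\<omega>. grid_index k (T \<omega>) = j} \<omega> *\<^sub>R f (real j / real (Suc k)) \<omega>) =
    (\<Sum>j\<in>{grid_index k (T \<omega>)}. f (real j / real (Suc k)) \<omega>)"
    by (intro sum.mono_neutral_cong_right) (auto simp: grid_index_def)
  thus ?thesis by simp
qed

lemma measurable_brownian: "t \<ge> 0 \<Longrightarrow> B t \<in> borel_measurable M"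
  using bm by (simp add: brownian_motion_def)

lemma measurable_grid_index [measurable]: "grid_index k \<in> borel \<rightarrow>\<^sub>M count_space UNIV"
  unfolding grid_index_def by measurable

lemma measurable_brownian_grid:
  "(\<lambda>\<omega>. B (real (grid_index k (T \<omega>)) / real (Suc k)) \<omega>) \<in> borel_measurable M"
proof -
  note [measurable] = measurable_brownian
  show ?thesis by (subst brownian_random_time_sum[where f = B]) measurable
qed

text \<open>
  Path continuity. Evaluation of a path at a random time is not measurable on the product
  \<open>\<sigma>\<close>-algebra that carries the independence, so \<open>B\<^sub>T\<close> has to be reached through rounded times.
\<close>
lemma brownian_grid_LIMSEQ:
  assumes "\<omega> \<in> space M"
  shows "(\<lambda>k. B (real (grid_index k (T \<omega>)) / real (Suc k)) \<omega>) \<longlonglongrightarrow> B (T \<omega>) \<omega>"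
proof (rule continuous_on_tendsto_compose[where s = "{0..}" and f = "\<lambda>t. B t \<omega>"])
  show "continuous_on {0..} (\<lambda>t. B t \<omega>)" using bm assms by (simp add: brownian_motion_def)
qed (use assms T_nonneg grid_index_LIMSEQ in auto)

lemma measurable_brownian_random_time: "(\<lambda>\<omega>. B (T \<omega>) \<omega>) \<in> borel_measurable M"
  by (rule borel_measurable_LIMSEQ_real[OF brownian_grid_LIMSEQ measurable_brownian_grid])

text \<open>
  On each event that the rounded time takes a given value, this event and the value of the process at
  that fixed time are independent.
\<close>
lemma char_brownian_grid:
  "(LINT \<omega>|M. iexp (u * B (real (grid_index k (T \<omega>)) / real (Suc k)) \<omega>)) =
   (LINT \<omega>|M. of_real (exp (- (u\<^sup>2 * (real (grid_index k (T \<omega>)) / real (Suc k)) / 2))))"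
proof -
  note [measurable] = measurable_brownian measurable_brownian_grid
  let ?I = "\<lambda>j \<omega>. indicator {\<omega>. grid_index k (T \<omega>) = j} \<omega> :: real"
  let ?t = "\<lambda>j. real j / real (Suc k)"
  have [measurable]: "?I j \<in> borel_measurable M" for j by measurable
  have int: "integrable M (\<lambda>\<omega>. ?I j \<omega> *\<^sub>R (f \<omega> :: complex))"
    if [measurable]: "f \<in> borel_measurable M" and "\<And>\<omega>. cmod (f \<omega>) \<le> 1" for f j
    by (rule integrable_const_bound[of _ 1]) (use that in \<open>auto simp: indicator_def\<close>)
  have *: "(LINT \<omega>|M. ?I j \<omega> *\<^sub>R iexp (u * B (?t j) \<omega>)) =
        (LINT \<omega>|M. ?I j \<omega> *\<^sub>R of_real (exp (- (u\<^sup>2 * ?t j / 2))))" for j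
  proof -
    define g where "g s = (if grid_index k s = j then 1 else 0 :: complex)" for s
    have gI: "g (T \<omega>) = of_real (?I j \<omega>)" for \<omega> by (simp add: g_def)
    have [measurable]: "g \<in> borel_measurable borel" unfolding g_def by measurable
    have "indep_var borel T borel (B (?t j))"
      by (rule indep_var_time_brownian[OF ind]) auto
    hence iv: "indep_var borel (g \<circ> T) borel ((\<lambda>x. iexp (u * x)) \<circ> B (?t j))"
      by (rule indep_var_compose) auto
    have "(LINT \<omega>|M. ?I j \<omega> *\<^sub>R iexp (u * B (?t j) \<omega>)) =
        (LINT \<omega>|M. (g \<circ> T) \<omega> * ((\<lambda>x. iexp (u * x)) \<circ> B (?t j)) \<omega>)"
      by (simp add: gI scaleR_conv_of_real)
    also have "\<dots> = (LINT \<omega>|M. (g \<circ> T) \<omega>) * (LINT \<omega>|M. ((\<lambda>x. iexp (u * x)) \<circ> B (?t j)) \<omega>)"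
      by (intro indep_var_lebesgue_integral iv integrable_const_bound[of _ 1])
         (auto simp: g_def comp_def)
    also have "(LINT \<omega>|M. ((\<lambda>x. iexp (u * x)) \<circ> B (?t j)) \<omega>) = of_real (exp (- (u\<^sup>2 * ?t j / 2)))"
      using brownian_motion_char[OF bm, of "?t j" u] by (simp add: comp_def)
    also have "(LINT \<omega>|M. (g \<circ> T) \<omega>) * of_real (exp (- (u\<^sup>2 * ?t j / 2))) =
        (LINT \<omega>|M. ?I j \<omega> *\<^sub>R of_real (exp (- (u\<^sup>2 * ?t j / 2))))"
      by (simp add: comp_def gI scaleR_conv_of_real)
    finally show ?thesis .
  qed
  have "(LINT \<omega>|M. iexp (u * B (real (grid_index k (T \<omega>)) / real (Suc k)) \<omega>)) =
      (LINT \<omega>|M. (\<Sum>j\<le>(Suc k)\<^sup>2. ?I j \<omega> *\<^sub>R iexp (u * B (?t j) \<omega>)))"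
    by (subst brownian_random_time_sum[where f = "\<lambda>t \<omega>. iexp (u * B t \<omega>)"]) simp
  also have "\<dots> = (\<Sum>j\<le>(Suc k)\<^sup>2. LINT \<omega>|M. ?I j \<omega> *\<^sub>R iexp (u * B (?t j) \<omega>))"
    by (intro Bochner_Integration.integral_sum int) auto
  also have "\<dots> = (\<Sum>j\<le>(Suc k)\<^sup>2. LINT \<omega>|M. ?I j \<omega> *\<^sub>R of_real (exp (- (u\<^sup>2 * ?t j / 2))))"
    by (simp only: *)
  also have "\<dots> = (LINT \<omega>|M. (\<Sum>j\<le>(Suc k)\<^sup>2. ?I j \<omega> *\<^sub>R of_real (exp (- (u\<^sup>2 * ?t j / 2)))))"
    by (intro Bochner_Integration.integral_sum[symmetric] int) auto
  also have "\<dots> = (LINT \<omega>|M. of_real (exp (- (u\<^sup>2 * (real (grid_index k (T \<omega>)) / real (Suc k)) / 2))))"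
    by (subst brownian_random_time_sum[where f = "\<lambda>t \<omega>. of_real (exp (- (u\<^sup>2 * t / 2)))"]) simp
  finally show ?thesis .
qed

lemma char_brownian_random_time:
  "(LINT \<omega>|M. iexp (u * B (T \<omega>) \<omega>)) = (LINT \<omega>|M. of_real (exp (- (u\<^sup>2 * T \<omega> / 2))))"
proof (rule LIMSEQ_unique)
  note [measurable] = measurable_brownian_grid measurable_brownian_random_time
  show "(\<lambda>k. LINT \<omega>|M. iexp (u * B (real (grid_index k (T \<omega>)) / real (Suc k)) \<omega>))
          \<longlonglongrightarrow> (LINT \<omega>|M. iexp (u * B (T \<omega>) \<omega>))"
    by (rule integral_dominated_convergence[where w = "\<lambda>_. 1"])
       (auto intro!: tendsto_intros AE_I2 brownian_grid_LIMSEQ simp del: of_nat_Suc)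
  show "(\<lambda>k. LINT \<omega>|M. iexp (u * B (real (grid_index k (T \<omega>)) / real (Suc k)) \<omega>))
          \<longlonglongrightarrow> (LINT \<omega>|M. of_real (exp (- (u\<^sup>2 * T \<omega> / 2))))"
    unfolding char_brownian_grid
  proof (rule integral_dominated_convergence[where w = "\<lambda>_. 1"], goal_cases)
    case 4
    have "isCont (\<lambda>t. complex_of_real (exp (- (u\<^sup>2 * t / 2)))) t" for t
      by (intro continuous_intros) auto
    thus ?case
      by (intro AE_I2 isCont_tendsto_compose[where g = "\<lambda>t. complex_of_real (exp (- (u\<^sup>2 * t / 2)))"]
            grid_index_LIMSEQ T_nonneg)
  qed auto
qed

text \<open>
  Both sides have the characteristic function \<open>E (exp (- u\<^sup>2 * T / 2))\<close>.
\<close>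
lemma distr_brownian_random_time:
  "distr M borel (\<lambda>\<omega>. B (T \<omega>) \<omega>) =
   distr (M \<Otimes>\<^sub>M std_normal_distribution) borel (\<lambda>(\<omega>, z). sqrt (T \<omega>) * z)"
proof (rule Levy_uniqueness)
  note [measurable] = measurable_brownian_random_time
  interpret N: real_distribution std_normal_distribution by (rule real_dist_normal_dist)
  interpret P: pair_prob_space M std_normal_distribution ..
  show "real_distribution (distr M borel (\<lambda>\<omega>. B (T \<omega>) \<omega>))"
    by (rule real_distribution_distr) measurable
  show "real_distribution (distr (M \<Otimes>\<^sub>M std_normal_distribution) borel (\<lambda>(\<omega>, z). sqrt (T \<omega>) * z))"
    by (rule P.real_distribution_distr) measurable
  show "char (distr M borel (\<lambda>\<omega>. B (T \<omega>) \<omega>)) =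
      char (distr (M \<Otimes>\<^sub>M std_normal_distribution) borel (\<lambda>(\<omega>, z). sqrt (T \<omega>) * z))"
  proof
    fix u
    have "char (distr (M \<Otimes>\<^sub>M std_normal_distribution) borel (\<lambda>(\<omega>, z). sqrt (T \<omega>) * z)) u =
        (LINT p|(M \<Otimes>\<^sub>M std_normal_distribution). iexp (u * (case p of (\<omega>, z) \<Rightarrow> sqrt (T \<omega>) * z)))"
      unfolding char_def by (subst integral_distr) auto
    also have "\<dots> = (LINT \<omega>|M. LINT z|std_normal_distribution. iexp (u * (sqrt (T \<omega>) * z)))"
      by (subst P.integral_fst'[symmetric]) (auto intro!: P.integrable_const_bound[of _ 1])
    also have "\<dots> = (LINT \<omega>|M. char std_normal_distribution (u * sqrt (T \<omega>)))"
      by (simp add: char_def mult_ac)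
    also have "\<dots> = (LINT \<omega>|M. of_real (exp (- (u\<^sup>2 * T \<omega> / 2))))"
      by (intro Bochner_Integration.integral_cong)
         (auto simp: char_std_normal_distribution power_mult_distrib T_nonneg)
    also have "\<dots> = char (distr M borel (\<lambda>\<omega>. B (T \<omega>) \<omega>)) u"
      unfolding char_def char_brownian_random_time[symmetric] by (subst integral_distr) auto
    finally show "char (distr M borel (\<lambda>\<omega>. B (T \<omega>) \<omega>)) u =
      char (distr (M \<Otimes>\<^sub>M std_normal_distribution) borel (\<lambda>(\<omega>, z). sqrt (T \<omega>) * z)) u" ..
  qed
qed

end

section \<open>Mellin inversion\<close>

lemma integral_iexp_interval:
  assumes "a \<le> b" "t \<noteq> 0"
  shows "(LINT x|lborel. indicator {a..b} x *\<^sub>R iexp (-(t * x))) = (iexp (-(t * a)) - iexp (-(t * b))) / (\<i> * t)"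
proof -
  have "(LINT x|lborel. indicator {a..b} x *\<^sub>R iexp (-(t * x))) =
      (\<lambda>x. - iexp (-(t * x)) / (\<i> * t)) b - (\<lambda>x. - iexp (-(t * x)) / (\<i> * t)) a"
  proof (rule integral_FTC_Icc[OF assms(1)])
    show "((\<lambda>x. - iexp (-(t * x)) / (\<i> * t)) has_vector_derivative iexp (-(t * x))) (at x within {a..b})" for x
      unfolding has_vector_derivative_complex_iff
      using assms(2) by (auto intro!: derivative_eq_intros simp: Re_exp Im_exp Re_divide Im_divide power2_eq_square field_simps)
    show "continuous_on {a..b} (\<lambda>x. iexp (-(t * x)))"
      by (intro continuous_intros)
  qed
  thus ?thesis by (simp add: diff_divide_distrib)
qed

definition inverse_fourier :: "(real \<Rightarrow> complex) \<Rightarrow> real \<Rightarrow> complex" where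
  "inverse_fourier \<phi> x = 1 / (2 * pi) * (LINT v|lborel. iexp (-(v * x)) * \<phi> v)"

lemma continuous_inverse_fourier:
  assumes [measurable]: "integrable lborel \<phi>"
  shows "continuous_on A (inverse_fourier \<phi>)"
proof (rule continuous_on_subset[OF _ subset_UNIV], unfold continuous_on_sequentially, intro allI impI ballI, elim conjE)
  fix X :: "nat \<Rightarrow> real" and x assume X: "X \<longlonglongrightarrow> x"
  have "(\<lambda>n. LINT v|lborel. iexp (-(v * X n)) * \<phi> v) \<longlonglongrightarrow> (LINT v|lborel. iexp (-(v * x)) * \<phi> v)"
    by (rule integral_dominated_convergence[where w = "\<lambda>v. cmod (\<phi> v)"])
       (use assms in \<open>auto simp: norm_mult intro!: tendsto_intros X AE_I2\<close>)
  thus "(inverse_fourier \<phi> \<circ> X) \<longlonglongrightarrow> inverse_fourier \<phi> x"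
    unfolding inverse_fourier_def comp_def by (intro tendsto_intros)
qed

text \<open>
  For an integrable characteristic function the truncated integrals in Levy's formula converge by
  dominated convergence. The quotient in that formula is the integral of \<open>exp (- \<i> * t * x)\<close> over
  \<open>{a..b}\<close>, and Fubini's theorem exchanges it with the integral over \<open>t\<close>.
\<close>
lemma (in real_distribution) measure_Ioc_eq_integral_inverse_fourier:
  assumes int [measurable]: "integrable lborel (char M)"
    and ab: "a \<le> b" and atoms: "measure M {a} = 0" "measure M {b} = 0"
  shows "complex_of_real (measure M {a<..b}) = integral {a..b} (inverse_fourier (char M))"
proof -
  define F where "F t = (iexp (-(t * a)) - iexp (-(t * b))) / (\<i> * t)" for t :: real
  have [measurable]: "F \<in> borel_measurable borel" unfolding F_def by measurable
  have F_le: "cmod (F t) \<le> b - a" for t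
  proof (cases "t = 0")
    case False
    thus ?thesis using Levy_Inversion_aux2[of "-b" "-a" t] ab by (simp add: F_def)
  qed (use ab in \<open>simp add: F_def\<close>)
  have lim1: "(\<lambda>n. 1 / (2 * pi) * (CLBINT t=-real n..real n. F t * char M t)) \<longlonglongrightarrow> of_real (measure M {a<..b})"
    using Levy_Inversion[OF ab atoms] unfolding F_def
    by (simp only: of_real_divide of_real_mult of_real_1 of_real_numeral of_int_minus of_int_of_nat_eq)
  have lim2: "(\<lambda>n. 1 / (2 * pi) * (CLBINT t=-real n..real n. F t * char M t)) \<longlonglongrightarrow>
      1 / (2 * pi) * (LINT t|lborel. F t * char M t)"
  proof (intro tendsto_intros)
    have eq: "(CLBINT t=-real n..real n. F t * char M t) =
        (LINT t|lborel. indicator {-real n<..<real n} t *\<^sub>R (F t * char M t))" for n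
      by (subst interval_integral_Ioo) (auto simp: set_lebesgue_integral_def)
    show "(\<lambda>n. CLBINT t=-real n..real n. F t * char M t) \<longlonglongrightarrow> (LINT t|lborel. F t * char M t)"
      unfolding eq
    proof (rule integral_dominated_convergence[where w = "\<lambda>t. (b - a) * cmod (char M t)"])
      show "integrable lborel (\<lambda>t. (b - a) * cmod (char M t))"
        using int by simp
      show "AE t in lborel. (\<lambda>n. indicator {-real n<..<real n} t *\<^sub>R (F t * char M t)) \<longlonglongrightarrow> F t * char M t"
      proof (rule AE_I2, rule tendsto_eventually)
        fix t
        obtain N where "real N > \<bar>t\<bar>" using reals_Archimedean2 by blast
        thus "\<forall>\<^sub>F n in sequentially. indicator {-real n<..<real n} t *\<^sub>R (F t * char M t) = F t * char M t"
          by (intro eventually_sequentiallyI[of N]) (auto simp: indicator_def)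
      qed
      show "AE t in lborel. norm (indicator {-real n<..<real n} t *\<^sub>R (F t * char M t)) \<le> (b - a) * cmod (char M t)" for n
        using F_le ab by (intro AE_I2) (auto simp: norm_mult indicator_def mult_right_mono)
    qed measurable
  qed
  have meas: "complex_of_real (measure M {a<..b}) = 1 / (2 * pi) * (LINT t|lborel. F t * char M t)"
    using LIMSEQ_unique[OF lim1 lim2] .
  \<comment> \<open>the integrand for Fubini; the indicator makes it integrable jointly in \<open>t\<close> and \<open>x\<close>\<close>
  define h where "h t x = indicator {a..b} x *\<^sub>R (iexp (-(t * x)) * char M t)" for t x
  have hm [measurable]: "case_prod h \<in> borel_measurable (lborel \<Otimes>\<^sub>M lborel)"
    unfolding h_def by measurable
  have hn: "norm (h t x) = indicator {a..b} x * cmod (char M t)" for t x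
    by (simp add: h_def norm_mult)
  have hint: "integrable (lborel \<Otimes>\<^sub>M lborel) (case_prod h)"
  proof (rule lborel_pair.Fubini_integrable)
    have "(\<lambda>t. LINT x|lborel. norm (case_prod h (t, x))) = (\<lambda>t. (b - a) * cmod (char M t))"
      using ab by (simp add: hn fun_eq_iff)
    thus "integrable lborel (\<lambda>t. LINT x|lborel. norm (case_prod h (t, x)))" using int by simp
    have "integrable lborel (h t)" for t
    proof (rule Bochner_Integration.integrable_bound)
      show "integrable lborel (\<lambda>x. indicator {a..b} x * cmod (char M t))"
        by (intro integrable_mult_left integrable_real_indicator) (auto simp: emeasure_lborel_Icc_eq)
      show "h t \<in> borel_measurable lborel" unfolding h_def by measurable
    qed (auto simp: hn)
    thus "AE t in lborel. integrable lborel (\<lambda>x. case_prod h (t, x))" by simp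
  qed measurable
  have "(LINT t|lborel. F t * char M t) = (LINT t|lborel. LINT x|lborel. h t x)"
  proof (rule integral_cong_AE)
    have "AE t in lborel. t \<noteq> (0::real)" by (rule AE_lborel_singleton)
    moreover have "F t * char M t = (LINT x|lborel. h t x)" if "t \<noteq> 0" for t
    proof -
      have "(LINT x|lborel. h t x) = (LINT x|lborel. (indicator {a..b} x *\<^sub>R iexp (-(t * x))) * char M t)"
        by (simp add: h_def)
      also have "\<dots> = (LINT x|lborel. indicator {a..b} x *\<^sub>R iexp (-(t * x))) * char M t"
        by (rule integral_mult_left_zero)
      finally show ?thesis using integral_iexp_interval[OF ab that] by (simp add: F_def)
    qed
    ultimately show "AE t in lborel. F t * char M t = (LINT x|lborel. h t x)" by auto
  qed measurable
  also have "\<dots> = (LINT x|lborel. LINT t|lborel. h t x)"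
    by (rule lborel_pair.Fubini_integral[OF hint, symmetric])
  also have "\<dots> = (LINT x|lborel. indicator {a..b} x *\<^sub>R (LINT t|lborel. iexp (-(t * x)) * char M t))"
    by (simp add: h_def)
  also have "1 / (2 * pi) * \<dots> = (LINT x|lborel. indicator {a..b} x *\<^sub>R inverse_fourier (char M) x)"
    by (simp add: inverse_fourier_def flip: integral_mult_right_zero)
  also have "\<dots> = integral {a..b} (inverse_fourier (char M))"
  proof -
    have "set_integrable lborel {a..b} (inverse_fourier (char M))"
      unfolding set_integrable_def by (intro borel_integrable_compact continuous_inverse_fourier int) auto
    thus ?thesis by (metis set_borel_integral_eq_integral(2) set_lebesgue_integral_def)
  qed
  finally show ?thesis using meas by simp
qed

text \<open>
  The right-hand side of \<open>measure_Ioc_eq_integral_inverse_fourier\<close> is differentiable in the upper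
  end point because the inverse transform is continuous.
\<close>
lemma (in real_distribution) measure_derivative_eq_inverse_fourier:
  assumes int: "integrable lborel (char M)" and atoms: "\<And>y. measure M {y} = 0"
    and deriv: "((\<lambda>y. measure M {a<..y}) has_real_derivative d) (at x)" and "a < x"
  shows "complex_of_real d = inverse_fourier (char M) x"
proof (rule vector_derivative_unique_at)
  show "((\<lambda>y. complex_of_real (measure M {a<..y})) has_vector_derivative of_real d) (at x)"
    using deriv by (intro has_vector_derivative_of_real)
      (simp add: has_real_derivative_iff_has_vector_derivative)
  have "((\<lambda>y. integral {a..y} (inverse_fourier (char M))) has_vector_derivative
      inverse_fourier (char M) x) (at x within {a..x+1})"
    using \<open>a < x\<close> by (intro integral_has_vector_derivative continuous_inverse_fourier int) auto
  hence "((\<lambda>y. integral {a..y} (inverse_fourier (char M))) has_vector_derivative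
      inverse_fourier (char M) x) (at x)"
    using \<open>a < x\<close> by (simp add: at_within_Icc_at)
  moreover have "\<forall>\<^sub>F y in nhds x. integral {a..y} (inverse_fourier (char M)) = of_real (measure M {a<..y})"
    using eventually_nhds_in_open[of "{a<..}" x] \<open>a < x\<close>
    by (auto elim!: eventually_mono simp: measure_Ioc_eq_integral_inverse_fourier[OF int _ atoms atoms])
  ultimately show "((\<lambda>y. complex_of_real (measure M {a<..y})) has_vector_derivative
      inverse_fourier (char M) x) (at x)"
    by (subst (asm) has_vector_derivative_cong_ev) (auto dest: eventually_nhds_x_imp_x elim: eventually_mono)
qed

text \<open>
  The law \<open>Q\<close> of the logarithm of a variable with density proportional to \<open>p x * x powr (\<gamma> - 1)\<close>
  has the Mellin transform on the line \<open>Re z = \<gamma>\<close>, divided by its value \<open>c\<close> at \<open>\<gamma>\<close>, as its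
  characteristic function. So Mellin inversion is Fourier inversion for \<open>Q\<close>. Continuity of \<open>p\<close> turns
  the identity of measures of intervals into one at every point.
\<close>
lemma mellin_inversion:
  assumes p_meas [measurable]: "p \<in> borel_measurable borel"
    and p_nonneg: "\<And>x. p x \<ge> 0"
    and p_cont: "continuous_on {0<..} p"
    and nz: "\<not> (AE x in lborel. x > 0 \<longrightarrow> p x = 0)"
    and mint: "set_integrable lborel {0<..} (\<lambda>x. complex_of_real (p x) * complex_of_real x powr (Complex \<gamma> 0 - 1))"
    and Mint: "integrable lborel (\<lambda>v. mellin p (Complex \<gamma> v))"
    and x: "x > 0"
  shows "complex_of_real (p x) =
    1 / (2 * pi) * (LINT v|lborel. complex_of_real x powr (- Complex \<gamma> v) * mellin p (Complex \<gamma> v))"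
proof -
  define k where "k x = indicator {0<..} x * (p x * x powr (\<gamma> - 1))" for x
  have [measurable]: "k \<in> borel_measurable borel" unfolding k_def by measurable
  have k_nonneg: "k x \<ge> 0" for x by (simp add: k_def p_nonneg)
  have k_int: "integrable lborel k"
  proof -
    have "integrable lborel (\<lambda>x. complex_of_real (k x))"
      using mint unfolding set_integrable_def
    proof (rule Bochner_Integration.integrable_cong[THEN iffD1, rotated 2])
      fix x :: real
      have "Complex \<gamma> 0 - 1 = complex_of_real (\<gamma> - 1)" by (simp add: complex_eq_iff)
      thus "indicat_real {0<..} x *\<^sub>R (complex_of_real (p x) * complex_of_real x powr (Complex \<gamma> 0 - 1)) =
        complex_of_real (k x)"
        using powr_of_real[of x "\<gamma> - 1"] by (simp add: k_def indicator_def)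
    qed simp
    thus ?thesis by (simp only: complex_of_real_integrable_eq)
  qed
  define c where "c = integral\<^sup>L lborel k"
  have c_pos: "c > 0"
  proof -
    have "c \<noteq> 0"
    proof
      assume "c = 0"
      hence "AE x in lborel. k x = 0"
        using integral_nonneg_eq_0_iff_AE[OF k_int] k_nonneg by (simp add: c_def)
      hence "AE x in lborel. x > 0 \<longrightarrow> p x = 0"
        by eventually_elim (auto simp: k_def)
      thus False using nz by simp
    qed
    moreover have "c \<ge> 0" unfolding c_def by (intro integral_nonneg_AE AE_I2 k_nonneg)
    ultimately show ?thesis by simp
  qed
  define D where "D = density lborel (\<lambda>x. ennreal (k x / c))"
  \<comment> \<open>the law of the logarithm; in logarithmic coordinates Mellin inversion is Fourier inversion\<close>
  define Q where "Q = distr D borel ln"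
  have "emeasure D (space D) = 1"
  proof -
    have "emeasure D (space D) = (\<integral>\<^sup>+x. ennreal (k x / c) \<partial>lborel)"
      by (simp add: D_def emeasure_density)
    also have "\<dots> = ennreal (LINT x|lborel. k x / c)"
      using k_int k_nonneg c_pos by (intro nn_integral_eq_integral) auto
    also have "(LINT x|lborel. k x / c) = 1" using c_pos by (simp add: c_def[symmetric])
    finally show ?thesis by simp
  qed
  then interpret D: prob_space D by (rule prob_spaceI)
  have [measurable]: "ln \<in> borel_measurable D" by (simp add: D_def)
  interpret Q: real_distribution Q unfolding Q_def by (rule D.real_distribution_distr) simp
  have charQ: "char Q v = mellin p (Complex \<gamma> v) / c" for v
  proof -
    have "char Q v = (LINT x|lborel. (k x / c) *\<^sub>R iexp (v * ln x))"
      unfolding char_def Q_def D_def using k_nonneg c_pos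
      by (subst integral_distr, simp, simp, subst integral_density) auto
    also have "\<dots> = (LINT x|lborel. (indicator {0<..} x *\<^sub>R
        (complex_of_real (p x) * complex_of_real x powr (Complex \<gamma> v - 1))) / c)"
    proof (intro Bochner_Integration.integral_cong refl)
      fix x :: real
      show "(k x / c) *\<^sub>R iexp (v * ln x) = (indicator {0<..} x *\<^sub>R
        (complex_of_real (p x) * complex_of_real x powr (Complex \<gamma> v - 1))) / c"
      proof (cases "x > 0")
        case True
        have "complex_of_real x powr (Complex \<gamma> v - 1) = exp (of_real ((\<gamma> - 1) * ln x)) * iexp (v * ln x)"
        proof -
          have "(Complex \<gamma> v - 1) * of_real (ln x) = of_real ((\<gamma> - 1) * ln x) + \<i> * of_real (v * ln x)"
            by (simp add: complex_eq_iff)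
          thus ?thesis using True by (simp only: of_real_powr_complex_eq_exp exp_add)
        qed
        also have "exp (complex_of_real ((\<gamma> - 1) * ln x)) = of_real (x powr (\<gamma> - 1))"
          using True by (simp only: exp_of_real) (simp add: powr_def)
        finally show ?thesis using True by (simp add: k_def scaleR_conv_of_real)
      qed (simp add: k_def)
    qed
    also have "\<dots> = mellin p (Complex \<gamma> v) / c"
      by (simp add: mellin_def set_lebesgue_integral_def)
    finally show ?thesis .
  qed
  have charQ_int: "integrable lborel (char Q)"
    unfolding charQ using Mint by (intro integrable_divide_zero) auto
  have kc: "continuous_on {a..b} (\<lambda>x. k x / c)" if "a > 0" for a b
  proof -
    have "continuous_on {a..b} (\<lambda>x. p x * x powr (\<gamma> - 1) / c)"
      using that c_pos by (intro continuous_intros continuous_on_subset[OF p_cont]) auto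
    thus ?thesis by (rule continuous_on_cong[THEN iffD1, rotated 2]) (use that in \<open>auto simp: k_def\<close>)
  qed
  have ln_vimage: "ln -` A \<in> sets borel" if "A \<in> sets borel" for A :: "real set"
    using measurable_sets[OF borel_measurable_ln[OF measurable_ident] that] by simp
  have Q_Ioc: "measure Q {a<..b} = integral {exp a..exp b} (\<lambda>x. k x / c)" if "a \<le> b" for a b
  proof -
    have "emeasure Q {a<..b} = emeasure D (ln -` {a<..b} \<inter> space D)"
      unfolding Q_def by (intro emeasure_distr) auto
    also have "\<dots> = (\<integral>\<^sup>+x. ennreal (k x / c) * indicator (ln -` {a<..b}) x \<partial>lborel)"
      unfolding D_def by (subst emeasure_density) (auto intro!: ln_vimage)
    also have "\<dots> = (\<integral>\<^sup>+x. ennreal (indicator {exp a..exp b} x *\<^sub>R (k x / c)) \<partial>lborel)"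
    proof (rule nn_integral_cong_AE)
      have "AE x in lborel. x \<noteq> exp a" by (rule AE_lborel_singleton)
      thus "AE x in lborel. ennreal (k x / c) * indicator (ln -` {a<..b}) x =
          ennreal (indicator {exp a..exp b} x *\<^sub>R (k x / c))"
      proof eventually_elim
        case (elim x)
        show ?case
        proof (cases "x > 0")
          case True
          hence "ln x \<in> {a<..b} \<longleftrightarrow> x \<in> {exp a..exp b}"
            using elim exp_less_cancel_iff[of a "ln x"] exp_le_cancel_iff[of "ln x" b]
            by (simp del: exp_less_cancel_iff exp_le_cancel_iff) linarith
          thus ?thesis by (auto simp: indicator_def)
        next
          case False
          thus ?thesis by (simp add: k_def)
        qed
      qed
    qed
    also have "\<dots> = ennreal (LINT x|lborel. indicator {exp a..exp b} x *\<^sub>R (k x / c))"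
      using k_nonneg c_pos
      by (intro nn_integral_eq_integral borel_integrable_compact kc) auto
    also have "(LINT x|lborel. indicator {exp a..exp b} x *\<^sub>R (k x / c)) = integral {exp a..exp b} (\<lambda>x. k x / c)"
      using set_borel_integral_eq_integral(2)[of "{exp a..exp b}" "\<lambda>x. k x / c"]
        borel_integrable_compact[OF _ kc, of "exp a" "exp b"]
      by (simp add: set_integrable_def set_lebesgue_integral_def)
    finally have "emeasure Q {a<..b} = ennreal (integral {exp a..exp b} (\<lambda>x. k x / c))" .
    moreover have "integral {exp a..exp b} (\<lambda>x. k x / c) \<ge> 0"
      using k_nonneg c_pos
      by (intro Henstock_Kurzweil_Integration.integral_nonneg integrable_continuous_real kc) auto
    ultimately show ?thesis unfolding measure_def by (simp only: enn2real_ennreal)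
  qed
  have Q_atom: "measure Q {y} = 0" for y
  proof -
    have "emeasure Q {y} = emeasure D (ln -` {y} \<inter> space D)"
      unfolding Q_def by (intro emeasure_distr) auto
    also have "\<dots> = (\<integral>\<^sup>+x. ennreal (k x / c) * indicator (ln -` {y}) x \<partial>lborel)"
      unfolding D_def by (subst emeasure_density) (auto intro!: ln_vimage)
    also have "\<dots> = (\<integral>\<^sup>+x. 0 \<partial>(lborel :: real measure))"
    proof (rule nn_integral_cong_AE)
      have "AE x in lborel. x \<noteq> exp y" by (rule AE_lborel_singleton)
      thus "AE x in lborel. ennreal (k x / c) * indicator (ln -` {y}) x = 0"
      proof eventually_elim
        case (elim x)
        show ?case
        proof (cases "x > 0")
          case True
          hence "ln x \<noteq> y" using elim by auto
          thus ?thesis by (auto simp: indicator_def)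
        qed (simp add: k_def)
      qed
    qed
    finally show ?thesis by (simp add: measure_def)
  qed
  define y where "y = ln x"
  have xy: "x = exp y" using x by (simp add: y_def)
  \<comment> \<open>any point below \<open>y\<close> would do; the derivative does not depend on it\<close>
  define a where "a = y - 1"
  have "((\<lambda>u. integral {exp a..u} (\<lambda>x. k x / c)) has_vector_derivative k x / c) (at x within {exp a..exp (y+1)})"
    by (intro integral_has_vector_derivative kc) (auto simp: xy a_def)
  hence "((\<lambda>u. integral {exp a..u} (\<lambda>x. k x / c)) has_real_derivative k x / c) (at x)"
    by (subst (asm) at_within_Icc_at)
       (auto simp: xy a_def has_real_derivative_iff_has_vector_derivative)
  hence "((\<lambda>b. integral {exp a..exp b} (\<lambda>x. k x / c)) has_real_derivative k x / c * exp y) (at y)"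
    unfolding xy by (rule DERIV_chain2) (auto intro!: derivative_eq_intros)
  moreover have ev: "\<forall>\<^sub>F b in nhds y. integral {exp a..exp b} (\<lambda>x. k x / c) = measure Q {a<..b}"
    using eventually_nhds_in_open[of "{a<..}" y]
    by (auto elim!: eventually_mono simp: Q_Ioc a_def)
  ultimately have "((\<lambda>b. measure Q {a<..b}) has_real_derivative k x / c * exp y) (at y)"
    by (simp only: DERIV_cong_ev[OF refl ev refl])
  hence "complex_of_real (k x / c * exp y) = inverse_fourier (char Q) y"
    by (intro Q.measure_derivative_eq_inverse_fourier[OF charQ_int Q_atom]) (auto simp: a_def)
  also have "inverse_fourier (char Q) y =
      1 / (2 * pi) * (LINT v|lborel. iexp (-(v * y)) * mellin p (Complex \<gamma> v)) / c"
  proof -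
    have "(\<lambda>v. iexp (-(v * y)) * char Q v) = (\<lambda>v. (iexp (-(v * y)) * mellin p (Complex \<gamma> v)) / of_real c)"
      by (simp add: charQ)
    thus ?thesis
      unfolding inverse_fourier_def by (simp only: integral_divide_zero times_divide_eq_right)
  qed
  also have "k x / c * exp y = (k x * x) / c" by (simp add: xy)
  finally have "complex_of_real (k x * x) / of_real c =
      1 / (2 * pi) * (LINT v|lborel. iexp (-(v * y)) * mellin p (Complex \<gamma> v)) / of_real c"
    by (simp only: of_real_divide)
  hence 1: "complex_of_real (k x * x) =
      1 / (2 * pi) * (LINT v|lborel. iexp (-(v * y)) * mellin p (Complex \<gamma> v))"
    using c_pos by (simp only: divide_cancel_right of_real_eq_0_iff) simp
  have "k x * x = p x * x powr \<gamma>"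
    using x by (simp add: k_def powr_diff)
  hence "p x = x powr (-\<gamma>) * (k x * x)"
    using x by (simp add: powr_minus)
  hence "complex_of_real (p x) = of_real (x powr (-\<gamma>)) * complex_of_real (k x * x)"
    by (simp only: of_real_mult)
  also have "\<dots> = 1 / (2 * pi) * (LINT v|lborel. of_real (x powr (-\<gamma>)) * (iexp (-(v * y)) * mellin p (Complex \<gamma> v)))"
    unfolding 1 by simp
  also have "(\<lambda>v. of_real (x powr (-\<gamma>)) * (iexp (-(v * y)) * mellin p (Complex \<gamma> v))) =
      (\<lambda>v. complex_of_real x powr (- Complex \<gamma> v) * mellin p (Complex \<gamma> v))"
  proof
    fix v
    have "complex_of_real x powr (- Complex \<gamma> v) = of_real (x powr (-\<gamma>)) * iexp (-(v * y))"
    proof -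
      have "- Complex \<gamma> v * of_real y = of_real (- \<gamma> * y) + \<i> * of_real (-(v * y))"
        by (simp add: complex_eq_iff)
      hence "complex_of_real x powr (- Complex \<gamma> v) = exp (of_real (- \<gamma> * y)) * iexp (-(v * y))"
        using x unfolding y_def by (simp only: of_real_powr_complex_eq_exp exp_add)
      also have "exp (complex_of_real (- \<gamma> * y)) = of_real (x powr (-\<gamma>))"
        using x by (simp only: exp_of_real) (simp add: powr_def y_def)
      finally show ?thesis .
    qed
    thus "of_real (x powr (-\<gamma>)) * (iexp (-(v * y)) * mellin p (Complex \<gamma> v)) =
      complex_of_real x powr (- Complex \<gamma> v) * mellin p (Complex \<gamma> v)" by simp
  qed
  finally show ?thesis .
qed

section \<open>Variance of the empirical Mellin transform\<close>

text \<open>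
  The mixed terms \<open>E (Y i * cnj (Y j))\<close> vanish by independence.
\<close>
lemma (in prob_space) expectation_norm_sum_power2:
  fixes Y :: "'i \<Rightarrow> 'a \<Rightarrow> complex"
  assumes I: "finite I" and ind: "indep_vars (\<lambda>_. borel) Y I"
    and int: "\<And>i. i \<in> I \<Longrightarrow> integrable M (Y i)"
    and sq: "\<And>i. i \<in> I \<Longrightarrow> integrable M (\<lambda>\<omega>. (cmod (Y i \<omega>))\<^sup>2)"
    and mean: "\<And>i. i \<in> I \<Longrightarrow> expectation (Y i) = 0"
  shows "integrable M (\<lambda>\<omega>. (cmod (\<Sum>i\<in>I. Y i \<omega>))\<^sup>2)"
    and "expectation (\<lambda>\<omega>. (cmod (\<Sum>i\<in>I. Y i \<omega>))\<^sup>2) = (\<Sum>i\<in>I. expectation (\<lambda>\<omega>. (cmod (Y i \<omega>))\<^sup>2))"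
proof -
  have *: "integrable M (\<lambda>\<omega>. Y i \<omega> * cnj (Y j \<omega>)) \<and>
      expectation (\<lambda>\<omega>. Y i \<omega> * cnj (Y j \<omega>)) = (if i = j then of_real (expectation (\<lambda>\<omega>. (cmod (Y i \<omega>))\<^sup>2)) else 0)"
    if ij: "i \<in> I" "j \<in> I" for i j
  proof (cases "i = j")
    case True
    have "(\<lambda>\<omega>. Y i \<omega> * cnj (Y i \<omega>)) = (\<lambda>\<omega>. complex_of_real ((cmod (Y i \<omega>))\<^sup>2))"
      by (simp only: complex_norm_square)
    thus ?thesis using sq[OF ij(1)] True by (simp del: of_real_power)
  next
    case False
    \<comment> \<open>conjugating only one member of the independent pair keeps it independent\<close>
    define Z where "Z = (\<lambda>k \<omega>. if k = i then Y k \<omega> else cnj (Y k \<omega>))"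
    have [measurable]: "cnj \<in> borel_measurable borel"
      by (intro borel_measurable_continuous_onI continuous_intros)
    have iv: "indep_vars (\<lambda>_. borel) Z {i, j}"
      unfolding Z_def
      by (rule indep_vars_compose2[OF indep_vars_subset[OF ind], where Y = "\<lambda>k y. if k = i then y else cnj y"])
         (use ij in auto)
    have Zint: "integrable M (Z k)" if "k \<in> {i, j}" for k
      using int that ij by (cases "k = i") (auto simp: Z_def)
    have "expectation (\<lambda>\<omega>. \<Prod>k\<in>{i, j}. Z k \<omega>) = (\<Prod>k\<in>{i, j}. expectation (Z k))"
      by (rule indep_vars_lebesgue_integral[OF _ iv Zint]) auto
    moreover have "integrable M (\<lambda>\<omega>. \<Prod>k\<in>{i, j}. Z k \<omega>)"
      by (rule indep_vars_integrable[OF _ iv Zint]) auto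
    moreover have "expectation (Z i) = 0" using mean[OF ij(1)] by (simp add: Z_def)
    moreover have "(\<lambda>\<omega>. \<Prod>k\<in>{i, j}. Z k \<omega>) = (\<lambda>\<omega>. Y i \<omega> * cnj (Y j \<omega>))"
      using False by (auto simp: Z_def)
    ultimately show ?thesis using False by simp
  qed
  have eq: "complex_of_real ((cmod (\<Sum>i\<in>I. Y i \<omega>))\<^sup>2) = (\<Sum>i\<in>I. \<Sum>j\<in>I. Y i \<omega> * cnj (Y j \<omega>))" for \<omega>
    unfolding complex_norm_square by (simp add: sum_product)
  have int2: "integrable M (\<lambda>\<omega>. complex_of_real ((cmod (\<Sum>i\<in>I. Y i \<omega>))\<^sup>2))"
    unfolding eq using * by (intro Bochner_Integration.integrable_sum) blast
  thus "integrable M (\<lambda>\<omega>. (cmod (\<Sum>i\<in>I. Y i \<omega>))\<^sup>2)"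
    by (simp only: complex_of_real_integrable_eq)
  have "complex_of_real (expectation (\<lambda>\<omega>. (cmod (\<Sum>i\<in>I. Y i \<omega>))\<^sup>2)) =
      expectation (\<lambda>\<omega>. \<Sum>i\<in>I. \<Sum>j\<in>I. Y i \<omega> * cnj (Y j \<omega>))"
    unfolding eq[symmetric] by (rule integral_complex_of_real[symmetric])
  also have "\<dots> = (\<Sum>i\<in>I. \<Sum>j\<in>I. expectation (\<lambda>\<omega>. Y i \<omega> * cnj (Y j \<omega>)))"
  proof -
    have "expectation (\<lambda>\<omega>. \<Sum>i\<in>I. \<Sum>j\<in>I. Y i \<omega> * cnj (Y j \<omega>)) =
        (\<Sum>i\<in>I. expectation (\<lambda>\<omega>. \<Sum>j\<in>I. Y i \<omega> * cnj (Y j \<omega>)))"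
      using * by (intro Bochner_Integration.integral_sum Bochner_Integration.integrable_sum) blast
    also have "\<dots> = (\<Sum>i\<in>I. \<Sum>j\<in>I. expectation (\<lambda>\<omega>. Y i \<omega> * cnj (Y j \<omega>)))"
      using * by (intro sum.cong refl Bochner_Integration.integral_sum) blast
    finally show ?thesis .
  qed
  also have "\<dots> = (\<Sum>i\<in>I. \<Sum>j\<in>I. if i = j then of_real (expectation (\<lambda>\<omega>. (cmod (Y i \<omega>))\<^sup>2)) else 0)"
    using * by (intro sum.cong refl) blast
  also have "\<dots> = of_real (\<Sum>i\<in>I. expectation (\<lambda>\<omega>. (cmod (Y i \<omega>))\<^sup>2))"
    using I by simp
  finally show "expectation (\<lambda>\<omega>. (cmod (\<Sum>i\<in>I. Y i \<omega>))\<^sup>2) = (\<Sum>i\<in>I. expectation (\<lambda>\<omega>. (cmod (Y i \<omega>))\<^sup>2))"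
    by (simp only: of_real_eq_iff)
qed

lemma (in prob_space) expectation_norm_diff_mean_power2_le:
  fixes f :: "'a \<Rightarrow> complex"
  assumes "integrable M f" "integrable M (\<lambda>\<omega>. (cmod (f \<omega>))\<^sup>2)"
  shows "integrable M (\<lambda>\<omega>. (cmod (f \<omega> - expectation f))\<^sup>2)"
    and "expectation (\<lambda>\<omega>. (cmod (f \<omega> - expectation f))\<^sup>2) \<le> expectation (\<lambda>\<omega>. (cmod (f \<omega>))\<^sup>2)"
proof -
  define c where "c = expectation f"
  have eq: "(cmod (f \<omega> - c))\<^sup>2 = (cmod (f \<omega>))\<^sup>2 - 2 * Re (cnj c * f \<omega>) + (cmod c)\<^sup>2" for \<omega>
    unfolding cmod_power2 by (simp add: power2_eq_square algebra_simps)
  have int: "integrable M (\<lambda>\<omega>. Re (cnj c * f \<omega>))" 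
    using assms by (intro integrable_Re) auto
  show "integrable M (\<lambda>\<omega>. (cmod (f \<omega> - expectation f))\<^sup>2)"
    unfolding c_def[symmetric] eq using assms int by auto
  have "expectation (\<lambda>\<omega>. Re (cnj c * f \<omega>)) = Re (cnj c * c)"
    using assms by (simp add: c_def)
  also have "\<dots> = (cmod c)\<^sup>2" by (simp add: cmod_power2 flip: power2_eq_square)
  finally have "expectation (\<lambda>\<omega>. Re (cnj c * f \<omega>)) = (cmod c)\<^sup>2" .
  hence "expectation (\<lambda>\<omega>. (cmod (f \<omega> - c))\<^sup>2) = expectation (\<lambda>\<omega>. (cmod (f \<omega>))\<^sup>2) - (cmod c)\<^sup>2"
    unfolding eq using assms int by (simp add: prob_space del: complex_mult_cnj times_complex.sel complex_cnj_mult)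
  thus "expectation (\<lambda>\<omega>. (cmod (f \<omega> - expectation f))\<^sup>2) \<le> expectation (\<lambda>\<omega>. (cmod (f \<omega>))\<^sup>2)"
    by (simp add: c_def)
qed

lemma empirical_mellin_variance_le:
  assumes P: "prob_space P" and ind: "prob_space.indep_vars P (\<lambda>_. borel) X {1..n}"
    and law: "\<And>k. k \<in> {1..n} \<Longrightarrow> distr P borel (X k) = \<mu>" and n: "n \<ge> 1"
    and mom: "integrable \<mu> (\<lambda>x. \<bar>x\<bar> powr (2 * Re z - 2))"
  shows "(\<integral>\<^sup>+\<omega>. ennreal ((cmod (empirical_mellin n (\<lambda>k. X k \<omega>) z -
             (LINT x|\<mu>. complex_of_real \<bar>x\<bar> powr (z - 1))))\<^sup>2) \<partial>P)
         \<le> ennreal (1 / real n * (LINT x|\<mu>. \<bar>x\<bar> powr (2 * Re z - 2)))"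
proof -
  interpret P: prob_space P by fact
  define g where "g = (\<lambda>x. complex_of_real \<bar>x\<bar> powr (z - 1))"
  define c where "c = integral\<^sup>L \<mu> g"
  define K where "K = (LINT x|\<mu>. \<bar>x\<bar> powr (2 * Re z - 2))"
  define Y where "Y k \<omega> = g (X k \<omega>) - c" for k \<omega>
  have [measurable]: "g \<in> borel_measurable borel" unfolding g_def by measurable
  have X [measurable]: "X k \<in> borel_measurable P" if "k \<in> {1..n}" for k
    using ind that unfolding P.indep_vars_def by auto
  have g_sq: "(cmod (g x))\<^sup>2 = \<bar>x\<bar> powr (2 * Re z - 2)" for x
    by (simp add: g_def norm_of_real_powr_complex powr_def algebra_simps power2_eq_square exp_add[symmetric])
  have gX: "integrable P (\<lambda>\<omega>. (cmod (g (X k \<omega>)))\<^sup>2)" "P.expectation (\<lambda>\<omega>. (cmod (g (X k \<omega>)))\<^sup>2) = K"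
      "integrable P (\<lambda>\<omega>. g (X k \<omega>))" "P.expectation (\<lambda>\<omega>. g (X k \<omega>)) = c"
    if k: "k \<in> {1..n}" for k
  proof -
    note [measurable] = X[OF k]
    show sq: "integrable P (\<lambda>\<omega>. (cmod (g (X k \<omega>)))\<^sup>2)"
      using mom unfolding law[OF k, symmetric] g_sq by (subst (asm) integrable_distr_eq) auto
    show "P.expectation (\<lambda>\<omega>. (cmod (g (X k \<omega>)))\<^sup>2) = K"
      unfolding K_def law[OF k, symmetric] g_sq by (subst integral_distr) auto
    show "integrable P (\<lambda>\<omega>. g (X k \<omega>))"
    proof (rule Bochner_Integration.integrable_bound)
      show "integrable P (\<lambda>\<omega>. 1 + (cmod (g (X k \<omega>)))\<^sup>2)" using sq by auto
      have "t \<le> 1 + t\<^sup>2" for t :: real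
        using sum_squares_bound[of t 1] by (simp add: power2_eq_square) (smt (verit) zero_le_square)
      thus "AE \<omega> in P. norm (g (X k \<omega>)) \<le> norm (1 + (cmod (g (X k \<omega>)))\<^sup>2)" by auto
    qed measurable
    show "P.expectation (\<lambda>\<omega>. g (X k \<omega>)) = c"
      unfolding c_def law[OF k, symmetric] by (subst integral_distr) auto
  qed
  have Y: "integrable P (Y k)" "P.expectation (Y k) = 0" "integrable P (\<lambda>\<omega>. (cmod (Y k \<omega>))\<^sup>2)"
      "P.expectation (\<lambda>\<omega>. (cmod (Y k \<omega>))\<^sup>2) \<le> K" if k: "k \<in> {1..n}" for k
  proof -
    show "integrable P (Y k)" "P.expectation (Y k) = 0"
      unfolding Y_def using gX[OF k] by (auto simp: P.prob_space)
    show "integrable P (\<lambda>\<omega>. (cmod (Y k \<omega>))\<^sup>2)" "P.expectation (\<lambda>\<omega>. (cmod (Y k \<omega>))\<^sup>2) \<le> K"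
      using P.expectation_norm_diff_mean_power2_le[OF gX(3,1)[OF k]] gX(2,4)[OF k] by (simp_all add: Y_def)
  qed
  have indY: "P.indep_vars (\<lambda>_. borel) Y {1..n}"
    unfolding Y_def by (rule P.indep_vars_compose2[OF ind]) measurable
  have eq: "empirical_mellin n (\<lambda>k. X k \<omega>) z - c = (\<Sum>k=1..n. Y k \<omega>) / of_nat n" for \<omega>
    using n by (simp add: empirical_mellin_def Y_def g_def sum_subtractf field_simps)
  have "(\<integral>\<^sup>+\<omega>. ennreal ((cmod (empirical_mellin n (\<lambda>k. X k \<omega>) z - c))\<^sup>2) \<partial>P) =
      (\<integral>\<^sup>+\<omega>. ennreal ((cmod (\<Sum>k=1..n. Y k \<omega>))\<^sup>2 / (real n)\<^sup>2) \<partial>P)"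
    unfolding eq by (simp add: norm_divide power_divide)
  also have "\<dots> = ennreal (P.expectation (\<lambda>\<omega>. (cmod (\<Sum>k=1..n. Y k \<omega>))\<^sup>2 / (real n)\<^sup>2))"
    using P.expectation_norm_sum_power2(1)[OF _ indY Y(1,3,2)]
    by (intro nn_integral_eq_integral) auto
  also have "\<dots> \<le> ennreal (1 / real n * K)"
  proof (rule ennreal_leI)
    have "P.expectation (\<lambda>\<omega>. (cmod (\<Sum>k=1..n. Y k \<omega>))\<^sup>2 / (real n)\<^sup>2) =
        (\<Sum>k=1..n. P.expectation (\<lambda>\<omega>. (cmod (Y k \<omega>))\<^sup>2)) / (real n)\<^sup>2"
      using P.expectation_norm_sum_power2(2)[OF _ indY Y(1,3,2)] by simp
    also have "\<dots> \<le> (\<Sum>k=1..n. K) / (real n)\<^sup>2"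
      by (intro divide_right_mono sum_mono Y) auto
    also have "\<dots> = 1 / real n * K"
      using n by (simp add: power2_eq_square)
    finally show "P.expectation (\<lambda>\<omega>. (cmod (\<Sum>k=1..n. Y k \<omega>))\<^sup>2 / (real n)\<^sup>2) \<le> 1 / real n * K" .
  qed
  finally show ?thesis by (simp only: c_def g_def K_def)
qed

section \<open>Moments of normal scale mixtures\<close>

text \<open>
  The density carries no mass on the negative half-line, so the integral over \<open>{0<..}\<close> is an
  expectation.
\<close>
lemma mellin_eq_expectation:
  assumes dist: "distributed M lborel T (\<lambda>x. ennreal (p x))" and p: "\<And>x. p x \<ge> 0"
    and p_meas [measurable]: "p \<in> borel_measurable borel"
    and T: "\<And>\<omega>. \<omega> \<in> space M \<Longrightarrow> T \<omega> \<ge> 0"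
  shows "set_integrable lborel {0<..} (\<lambda>x. complex_of_real (p x) * complex_of_real x powr (z - 1)) \<longleftrightarrow>
           integrable M (\<lambda>\<omega>. complex_of_real (T \<omega>) powr (z - 1))"
    and "mellin p z = (LINT \<omega>|M. complex_of_real (T \<omega>) powr (z - 1))"
proof -
  define f where "f x = indicator {0<..} x *\<^sub>R complex_of_real \<bar>x\<bar> powr (z - 1)" for x
  have [measurable]: "f \<in> borel_measurable borel" unfolding f_def by measurable
  have [measurable]: "T \<in> borel_measurable M"
    using distributed_measurable[OF dist] by simp
  have law: "distr M lborel T = density lborel (\<lambda>x. ennreal (p x))"
    by (rule distributed_distr_eq_density[OF dist])
  have fT: "f (T \<omega>) = complex_of_real (T \<omega>) powr (z - 1)" if "\<omega> \<in> space M" for \<omega>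
    using T[OF that] by (simp add: f_def indicator_def)
  have fp: "p x *\<^sub>R f x = indicator {0<..} x *\<^sub>R (complex_of_real (p x) * complex_of_real x powr (z - 1))" for x
    by (simp add: f_def indicator_def scaleR_conv_of_real)
  have "integrable M (\<lambda>\<omega>. complex_of_real (T \<omega>) powr (z - 1)) \<longleftrightarrow> integrable M (\<lambda>\<omega>. f (T \<omega>))"
    by (intro Bochner_Integration.integrable_cong refl) (simp add: fT)
  also have "\<dots> \<longleftrightarrow> integrable (distr M lborel T) f"
    by (subst integrable_distr_eq) auto
  also have "\<dots> \<longleftrightarrow> integrable lborel (\<lambda>x. p x *\<^sub>R f x)"
    unfolding law using p by (subst integrable_density) auto
  finally show "set_integrable lborel {0<..} (\<lambda>x. complex_of_real (p x) * complex_of_real x powr (z - 1)) \<longleftrightarrow>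
           integrable M (\<lambda>\<omega>. complex_of_real (T \<omega>) powr (z - 1))"
    unfolding fp set_integrable_def ..
  have "(LINT \<omega>|M. complex_of_real (T \<omega>) powr (z - 1)) = (LINT \<omega>|M. f (T \<omega>))"
    by (intro Bochner_Integration.integral_cong refl) (simp add: fT)
  also have "\<dots> = (LINT x|distr M lborel T. f x)"
    by (subst integral_distr) auto
  also have "\<dots> = (LINT x|lborel. p x *\<^sub>R f x)"
    unfolding law using p by (subst integral_density) auto
  finally show "mellin p z = (LINT \<omega>|M. complex_of_real (T \<omega>) powr (z - 1))"
    unfolding fp mellin_def set_lebesgue_integral_def ..
qed

text \<open>
  The convention \<open>0 powr z = 0\<close> makes this hold at \<open>t = 0\<close> and at \<open>x = 0\<close> as well.
\<close>
lemma of_real_powr_sqrt_mult: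
  assumes "t \<ge> 0"
  shows "complex_of_real \<bar>sqrt t * x\<bar> powr (2 * z - 2) =
    complex_of_real t powr (z - 1) * complex_of_real \<bar>x\<bar> powr (2 * z - 2)"
proof (cases "t = 0 \<or> x = 0")
  case False
  hence tx: "t > 0" "x \<noteq> 0" using assms by auto
  have "(2 * z - 2) * of_real (ln \<bar>sqrt t * x\<bar>) = (z - 1) * of_real (ln t) + (2 * z - 2) * of_real (ln \<bar>x\<bar>)"
    using tx by (simp add: abs_mult ln_mult ln_sqrt field_simps)
  moreover have "\<bar>sqrt t * x\<bar> > 0" "\<bar>x\<bar> > 0" using tx by auto
  ultimately show ?thesis
    using tx(1) by (simp only: of_real_powr_complex_eq_exp exp_add)
qed auto

lemma moment_normal_scale_mixture:
  assumes M: "prob_space M" and T_meas [measurable]: "T \<in> borel_measurable M"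
    and T: "\<And>\<omega>. \<omega> \<in> space M \<Longrightarrow> T \<omega> \<ge> 0"
    and z: "Re z > 1/2" and Tint: "integrable M (\<lambda>\<omega>. complex_of_real (T \<omega>) powr (z - 1))"
  defines "\<mu> \<equiv> distr (M \<Otimes>\<^sub>M std_normal_distribution) borel (\<lambda>(\<omega>, x). sqrt (T \<omega>) * x)"
  shows "integrable \<mu> (\<lambda>x. complex_of_real \<bar>x\<bar> powr (2 * z - 2))"
    and "(LINT x|\<mu>. complex_of_real \<bar>x\<bar> powr (2 * z - 2)) =
      (LINT \<omega>|M. complex_of_real (T \<omega>) powr (z - 1)) * (2 powr (z - 1) * Gamma (z - 1/2) / of_real (sqrt pi))"
proof -
  interpret M: prob_space M by fact
  interpret N: real_distribution std_normal_distribution by (rule real_dist_normal_dist)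
  interpret P: pair_prob_space M std_normal_distribution ..
  define f where "f = (\<lambda>\<omega>. complex_of_real \<bar>T \<omega>\<bar> powr (z - 1))"
  define g where "g = (\<lambda>x. complex_of_real \<bar>x\<bar> powr (2 * z - 2))"
  have [measurable]: "g \<in> borel_measurable borel" "f \<in> borel_measurable M"
    unfolding g_def f_def by measurable
  have fT: "f \<omega> = complex_of_real (T \<omega>) powr (z - 1)" if "\<omega> \<in> space M" for \<omega>
    using T[OF that] by (simp add: f_def)
  have fint: "integrable M f"
    using Tint by (rule Bochner_Integration.integrable_cong[THEN iffD1, rotated 2]) (auto simp: fT)
  have gint: "integrable std_normal_distribution g"
    unfolding g_def using z by (rule std_normal_abs_powr_moment)
  have split: "g (case p of (\<omega>, x) \<Rightarrow> sqrt (T \<omega>) * x) = (case p of (\<omega>, x) \<Rightarrow> f \<omega> * g x)"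
    if "p \<in> space (M \<Otimes>\<^sub>M std_normal_distribution)" for p
    using that by (auto simp: space_pair_measure g_def fT of_real_powr_sqrt_mult[OF T])
  have prod_int: "integrable (M \<Otimes>\<^sub>M std_normal_distribution) (\<lambda>(\<omega>, x). f \<omega> * g x)"
  proof (rule P.Fubini_integrable)
    show "integrable M (\<lambda>\<omega>. LINT x|std_normal_distribution. norm (case (\<omega>, x) of (\<omega>, x) \<Rightarrow> f \<omega> * g x))"
      using fint by (simp add: norm_mult)
    show "AE \<omega> in M. integrable std_normal_distribution (\<lambda>x. case (\<omega>, x) of (\<omega>, x) \<Rightarrow> f \<omega> * g x)"
      using gint by simp
  qed measurable
  have "integrable (M \<Otimes>\<^sub>M std_normal_distribution) (\<lambda>p. g (case p of (\<omega>, x) \<Rightarrow> sqrt (T \<omega>) * x))"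
    using prod_int by (rule Bochner_Integration.integrable_cong[THEN iffD1, rotated 2]) (auto simp: split)
  thus "integrable \<mu> (\<lambda>x. complex_of_real \<bar>x\<bar> powr (2 * z - 2))"
    unfolding \<mu>_def g_def[symmetric] by (subst integrable_distr_eq) auto
  have "(LINT x|\<mu>. g x) = (LINT p|(M \<Otimes>\<^sub>M std_normal_distribution). g (case p of (\<omega>, x) \<Rightarrow> sqrt (T \<omega>) * x))"
    unfolding \<mu>_def by (subst integral_distr) auto
  also have "\<dots> = (LINT p|(M \<Otimes>\<^sub>M std_normal_distribution). (case p of (\<omega>, x) \<Rightarrow> f \<omega> * g x))"
    by (intro Bochner_Integration.integral_cong refl split)
  also have "\<dots> = (LINT \<omega>|M. LINT x|std_normal_distribution. f \<omega> * g x)"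
    using P.integral_fst'[OF prod_int] by simp
  also have "\<dots> = (LINT \<omega>|M. f \<omega>) * (LINT x|std_normal_distribution. g x)"
    by simp
  also have "(LINT \<omega>|M. f \<omega>) = (LINT \<omega>|M. complex_of_real (T \<omega>) powr (z - 1))"
    by (intro Bochner_Integration.integral_cong refl fT)
  also have "(LINT x|std_normal_distribution. g x) = 2 powr (z - 1) * Gamma (z - 1/2) / of_real (sqrt pi)"
    unfolding g_def using z by (rule std_normal_abs_powr_moment)
  finally show "(LINT x|\<mu>. complex_of_real \<bar>x\<bar> powr (2 * z - 2)) =
      (LINT \<omega>|M. complex_of_real (T \<omega>) powr (z - 1)) * (2 powr (z - 1) * Gamma (z - 1/2) / of_real (sqrt pi))"
    by (simp only: g_def)
qed

text \<open>
  The formula of \<open>std_normal_abs_powr_moment\<close> at the real point \<open>z = r / 2 + 1\<close>, as a modulus, so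
  that it is visibly real and non-negative.
\<close>
definition normal_abs_moment :: "real \<Rightarrow> real" where
  "normal_abs_moment r = cmod (2 powr of_real (r / 2) * Gamma (of_real ((r + 1) / 2)) / of_real (sqrt pi))"

lemma abs_moment_normal_scale_mixture_le:
  assumes M: "prob_space M" and T_meas [measurable]: "T \<in> borel_measurable M"
    and T: "\<And>\<omega>. \<omega> \<in> space M \<Longrightarrow> T \<omega> \<ge> 0"
    and r: "r > -1" and Tint: "(\<integral>\<^sup>+\<omega>. ennreal (T \<omega> powr (r / 2)) \<partial>M) \<le> ennreal m"
  defines "\<mu> \<equiv> distr (M \<Otimes>\<^sub>M std_normal_distribution) borel (\<lambda>(\<omega>, x). sqrt (T \<omega>) * x)"
  shows "integrable \<mu> (\<lambda>x. \<bar>x\<bar> powr r)"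
    and "(LINT x|\<mu>. \<bar>x\<bar> powr r) \<le> max m 0 * normal_abs_moment r"
proof -
  define z where "z = complex_of_real (r / 2 + 1)"
  have z: "Re z > 1/2" "2 * z - 2 = of_real r" "z - 1 = of_real (r / 2)" "z - 1/2 = of_real ((r + 1) / 2)"
    using r by (simp_all add: z_def field_simps)
  have fin: "integrable M (\<lambda>\<omega>. T \<omega> powr (r / 2))"
    by (rule integrableI_bounded) (use Tint in \<open>auto simp: less_top[symmetric] top_unique\<close>)
  have ET: "complex_of_real (T \<omega>) powr (z - 1) = of_real (T \<omega> powr (r / 2))" if "\<omega> \<in> space M" for \<omega>
    unfolding z using T[OF that] by (rule powr_of_real)
  have int: "integrable M (\<lambda>\<omega>. complex_of_real (T \<omega>) powr (z - 1))"
    using fin by (subst Bochner_Integration.integrable_cong[OF refl ET]) (auto simp only: complex_of_real_integrable_eq)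
  have eq: "complex_of_real \<bar>x\<bar> powr (2 * z - 2) = of_real (\<bar>x\<bar> powr r)" for x
    unfolding z by (rule powr_of_real) simp
  note mom = moment_normal_scale_mixture[OF M T_meas T z(1) int, folded \<mu>_def, unfolded eq]
  show "integrable \<mu> (\<lambda>x. \<bar>x\<bar> powr r)"
    using mom(1) by (simp only: complex_of_real_integrable_eq)
  have "complex_of_real (LINT x|\<mu>. \<bar>x\<bar> powr r) = (LINT \<omega>|M. of_real (T \<omega> powr (r / 2))) *
      (2 powr (z - 1) * Gamma (z - 1/2) / of_real (sqrt pi))"
    using mom(2) Bochner_Integration.integral_cong[OF refl ET, of M "\<lambda>x. x"] by (simp only: integral_complex_of_real)
  also have "\<dots> = of_real (LINT \<omega>|M. T \<omega> powr (r / 2)) *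
      (2 powr of_real (r / 2) * Gamma (of_real ((r + 1) / 2)) / of_real (sqrt pi))"
    by (simp only: integral_complex_of_real z)
  finally have "cmod (complex_of_real (LINT x|\<mu>. \<bar>x\<bar> powr r)) = 
      \<bar>LINT \<omega>|M. T \<omega> powr (r / 2)\<bar> * normal_abs_moment r"
    by (simp only: norm_mult norm_of_real normal_abs_moment_def)
  hence "(LINT x|\<mu>. \<bar>x\<bar> powr r) \<le> \<bar>LINT \<omega>|M. T \<omega> powr (r / 2)\<bar> * normal_abs_moment r"
    by simp
  also have "\<bar>LINT \<omega>|M. T \<omega> powr (r / 2)\<bar> \<le> max m 0"
  proof -
    have "ennreal (LINT \<omega>|M. T \<omega> powr (r / 2)) \<le> ennreal m"
      using Tint fin by (subst nn_integral_eq_integral[symmetric]) auto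
    moreover have "(LINT \<omega>|M. T \<omega> powr (r / 2)) \<ge> 0" by (intro integral_nonneg_AE) auto
    ultimately show ?thesis by (auto simp: ennreal_le_iff2 max_def)
  qed
  finally show "(LINT x|\<mu>. \<bar>x\<bar> powr r) \<le> max m 0 * normal_abs_moment r"
    by (simp add: normal_abs_moment_def mult_right_mono)
qed

section \<open>The stochastic error\<close>

text \<open>
  Cauchy-Schwarz for the two factors \<open>sqrt w\<close> and \<open>sqrt w * Y\<close>, then Tonelli. It plays the role of
  Minkowski's integral inequality.
\<close>
lemma nn_integral_weighted_power2_le:
  fixes w :: "'v \<Rightarrow> real" and Y :: "'a \<Rightarrow> 'v \<Rightarrow> ennreal"
  assumes "sigma_finite_measure P" "sigma_finite_measure V"
    and [measurable]: "w \<in> borel_measurable V" "case_prod Y \<in> borel_measurable (P \<Otimes>\<^sub>M V)"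
    and w: "\<And>v. w v \<ge> 0" and Y: "\<And>v. (\<integral>\<^sup>+\<omega>. (Y \<omega> v)\<^sup>2 \<partial>P) \<le> \<kappa>"
  shows "(\<integral>\<^sup>+\<omega>. (\<integral>\<^sup>+v. ennreal (w v) * Y \<omega> v \<partial>V)\<^sup>2 \<partial>P) \<le> (\<integral>\<^sup>+v. ennreal (w v) \<partial>V)\<^sup>2 * \<kappa>"
proof -
  interpret P: sigma_finite_measure P by fact
  interpret V: sigma_finite_measure V by fact
  interpret PV: pair_sigma_finite P V ..
  define W where "W = (\<integral>\<^sup>+v. ennreal (w v) \<partial>V)"
  have sq: "ennreal (sqrt (w v)) * ennreal (sqrt (w v)) = ennreal (w v)" for v
    using w by (simp flip: ennreal_mult')
  have "(\<integral>\<^sup>+v. ennreal (w v) * Y \<omega> v \<partial>V)\<^sup>2 \<le> W * (\<integral>\<^sup>+v. ennreal (w v) * (Y \<omega> v)\<^sup>2 \<partial>V)"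
    if [measurable]: "\<omega> \<in> space P" for \<omega>
  proof -
    have "(\<integral>\<^sup>+v. ennreal (sqrt (w v)) * (ennreal (sqrt (w v)) * Y \<omega> v) \<partial>V)\<^sup>2 \<le>
        (\<integral>\<^sup>+v. (ennreal (sqrt (w v)))\<^sup>2 \<partial>V) * (\<integral>\<^sup>+v. (ennreal (sqrt (w v)) * Y \<omega> v)\<^sup>2 \<partial>V)"
      by (rule Cauchy_Schwarz_nn_integral) measurable
    moreover have "(ennreal (sqrt (w v)))\<^sup>2 = ennreal (w v)" for v
      using sq by (simp add: power2_eq_square)
    moreover have "ennreal (sqrt (w v)) * (ennreal (sqrt (w v)) * Y \<omega> v) = ennreal (w v) * Y \<omega> v" for v
      by (simp only: mult.assoc[symmetric] sq)
    ultimately show ?thesis by (simp only: W_def power_mult_distrib)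
  qed
  hence "(\<integral>\<^sup>+\<omega>. (\<integral>\<^sup>+v. ennreal (w v) * Y \<omega> v \<partial>V)\<^sup>2 \<partial>P) \<le>
      (\<integral>\<^sup>+\<omega>. W * (\<integral>\<^sup>+v. ennreal (w v) * (Y \<omega> v)\<^sup>2 \<partial>V) \<partial>P)"
    by (rule nn_integral_mono)
  also have "\<dots> = W * (\<integral>\<^sup>+\<omega>. (\<integral>\<^sup>+v. ennreal (w v) * (Y \<omega> v)\<^sup>2 \<partial>V) \<partial>P)"
    by (rule nn_integral_cmult) measurable
  also have "(\<integral>\<^sup>+\<omega>. (\<integral>\<^sup>+v. ennreal (w v) * (Y \<omega> v)\<^sup>2 \<partial>V) \<partial>P) =
      (\<integral>\<^sup>+v. (\<integral>\<^sup>+\<omega>. ennreal (w v) * (Y \<omega> v)\<^sup>2 \<partial>P) \<partial>V)"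
    by (rule PV.Fubini'[symmetric]) measurable
  also have "\<dots> = (\<integral>\<^sup>+v. ennreal (w v) * (\<integral>\<^sup>+\<omega>. (Y \<omega> v)\<^sup>2 \<partial>P) \<partial>V)"
    by (intro nn_integral_cong nn_integral_cmult) measurable
  also have "\<dots> \<le> (\<integral>\<^sup>+v. ennreal (w v) * \<kappa> \<partial>V)"
    by (intro nn_integral_mono mult_left_mono Y) auto
  also have "\<dots> = W * \<kappa>"
    unfolding W_def by (rule nn_integral_multc) measurable
  finally show ?thesis
    by (simp add: W_def power2_eq_square mult.assoc mult_left_mono)
qed

text \<open>
  The factor \<open>1 / (2 powr z * Gamma (z - 1/2))\<close> of the estimator at \<open>z = Complex \<gamma> v\<close>. Being
  entire, \<open>rGamma\<close> makes its continuity in \<open>v\<close> immediate.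
\<close>
definition deconvolution_factor :: "real \<Rightarrow> real \<Rightarrow> complex" where
  "deconvolution_factor \<gamma> v = rGamma (Complex (\<gamma> - 1/2) v) / 2 powr Complex \<gamma> v"

lemma norm_deconvolution_factor:
  "cmod (deconvolution_factor \<gamma> v) = cmod (rGamma (Complex (\<gamma> - 1/2) v)) / 2 powr \<gamma>"
proof -
  have "cmod ((2::complex) powr Complex \<gamma> v) = 2 powr \<gamma>"
    using norm_of_real_powr_complex[of 2 "Complex \<gamma> v"] by simp
  thus ?thesis by (simp add: deconvolution_factor_def norm_divide)
qed

text \<open>
  The exponential of \<open>pi * \<bar>v\<bar> / 2\<close> is at most the sum of those of \<open>pi * v / 2\<close> and \<open>- pi * v / 2\<close>,
  which has an antiderivative on the whole interval. The minimum records that the integral is of order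
  \<open>U\<close> for small \<open>U\<close>, that is, for large bandwidths.
\<close>
lemma nn_integral_exp_abs_le:
  assumes "U > 0"
  shows "(\<integral>\<^sup>+v. ennreal (exp (pi * \<bar>v\<bar> / 2)) * indicator {-U..U} v \<partial>lborel) \<le>
    ennreal (4 / pi * min 1 (pi * U) * exp (pi * U / 2))"
proof -
  define F where "F v = 2 / pi * (exp (pi * v / 2) - exp (- pi * v / 2))" for v
  have "(\<integral>\<^sup>+v. ennreal (exp (pi * \<bar>v\<bar> / 2)) * indicator {-U..U} v \<partial>lborel) \<le>
      (\<integral>\<^sup>+v. ennreal (exp (pi * v / 2) + exp (- pi * v / 2)) * indicator {-U..U} v \<partial>lborel)"
    by (intro nn_integral_mono mult_right_mono ennreal_leI) (auto simp: abs_if)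
  also have "\<dots> = ennreal (F U - F (-U))"
    unfolding F_def using assms
    by (intro nn_integral_FTC_Icc) (auto intro!: derivative_eq_intros simp: field_simps)
  also have "F U - F (-U) = 4 / pi * (1 - exp (- pi * U)) * exp (pi * U / 2)"
    by (simp add: F_def field_simps flip: exp_add)
  also have "ennreal \<dots> \<le> ennreal (4 / pi * min 1 (pi * U) * exp (pi * U / 2))"
    using exp_ge_add_one_self[of "- pi * U"]
    by (intro ennreal_leI mult_right_mono mult_left_mono) auto
  finally show ?thesis .
qed

text \<open>
  For \<open>\<gamma> < 1\<close> the Gamma value comes from the shift by one in \<open>norm_rGamma_le_left\<close>.
\<close>
definition factor_const :: "real \<Rightarrow> real" where
  "factor_const \<gamma> = 1 / (2 powr \<gamma> * Gamma (if \<gamma> < 1 then \<gamma> + 1/2 else \<gamma> - 1/2))"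

lemma factor_const_nonneg: "\<gamma> > 1/2 \<Longrightarrow> factor_const \<gamma> \<ge> 0"
  by (auto simp: factor_const_def Gamma_real_nonneg)

text \<open>
  Let \<open>\<gamma> < 1\<close>. For \<open>U \<ge> 1\<close> the power \<open>(1 + 4 * U\<^sup>2) powr ((1 - \<gamma>) / 2)\<close> is of order
  \<open>U powr (1 - \<gamma>)\<close>. For smaller \<open>U\<close> it is at least one, and the required decay comes from the factor
  \<open>U\<close> of \<open>nn_integral_exp_abs_le\<close>, which is at most \<open>U powr (1 - \<gamma>)\<close>. So one bound serves every
  bandwidth.
\<close>
lemma nn_integral_deconvolution_factor_le:
  assumes \<gamma>: "\<gamma> > 1/2" and U: "U > 0"
  shows "(\<integral>\<^sup>+v. ennreal (indicator {-U..U} v * cmod (deconvolution_factor \<gamma> v)) \<partial>lborel) \<le>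
    ennreal (20 * factor_const \<gamma> * (if \<gamma> < 1 then U powr (1 - \<gamma>) else 1) * exp (pi * U / 2))"
proof -
  define D where "D = factor_const \<gamma>"
  have D: "D \<ge> 0" using \<gamma> by (simp add: D_def factor_const_nonneg)
  define s where "s = (if \<gamma> < 1 then (1 + 4 * U\<^sup>2) powr ((1 - \<gamma>) / 2) else 1)"
  have s: "s \<ge> 0" by (simp add: s_def)
  have "(\<integral>\<^sup>+v. ennreal (indicator {-U..U} v * cmod (deconvolution_factor \<gamma> v)) \<partial>lborel) \<le>
      (\<integral>\<^sup>+v. ennreal (D * s) * (ennreal (exp (pi * \<bar>v\<bar> / 2)) * indicator {-U..U} v) \<partial>lborel)"
  proof (rule nn_integral_mono)
    fix v :: real
    show "ennreal (indicator {-U..U} v * cmod (deconvolution_factor \<gamma> v)) \<le>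
        ennreal (D * s) * (ennreal (exp (pi * \<bar>v\<bar> / 2)) * indicator {-U..U} v)"
    proof (cases "v \<in> {-U..U}")
      case True
      have "cmod (deconvolution_factor \<gamma> v) \<le> D * s * exp (pi * \<bar>v\<bar> / 2)"
      proof (cases "\<gamma> < 1")
        case True
        note \<gamma>1 = this
        have "v\<^sup>2 \<le> U\<^sup>2" using \<open>v \<in> {-U..U}\<close> by (intro abs_le_square_iff[THEN iffD1]) auto
        hence "(1 + 4 * v\<^sup>2) powr ((1 - \<gamma>) / 2) \<le> s"
          using True by (simp add: s_def powr_mono2)
        hence "(1 + 4 * v\<^sup>2) powr ((1 - \<gamma>) / 2) * exp (pi * \<bar>v\<bar> / 2) / Gamma (\<gamma> + 1/2) \<le>
            s * exp (pi * \<bar>v\<bar> / 2) / Gamma (\<gamma> + 1/2)"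
          using \<gamma> by (intro divide_right_mono mult_right_mono) (auto simp: Gamma_real_nonneg)
        moreover have "\<gamma> - 1/2 + 1 = \<gamma> + 1/2" "(1/2 - (\<gamma> - 1/2)) / 2 = (1 - \<gamma>) / 2" by simp_all
        ultimately have "cmod (rGamma (Complex (\<gamma> - 1/2) v)) \<le> s * exp (pi * \<bar>v\<bar> / 2) / Gamma (\<gamma> + 1/2)"
          using norm_rGamma_le_left[of "\<gamma> - 1/2" v] \<gamma> \<gamma>1 by (simp only:) linarith
        hence "cmod (deconvolution_factor \<gamma> v) \<le> s * exp (pi * \<bar>v\<bar> / 2) / Gamma (\<gamma> + 1/2) / 2 powr \<gamma>"
          unfolding norm_deconvolution_factor by (rule divide_right_mono) simp
        thus ?thesis
          using \<gamma>1 by (simp add: D_def factor_const_def mult_ac)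
      next
        case False
        hence "cmod (deconvolution_factor \<gamma> v) \<le> exp (pi * \<bar>v\<bar> / 2) / Gamma (\<gamma> - 1/2) / 2 powr \<gamma>"
          unfolding norm_deconvolution_factor by (intro divide_right_mono norm_rGamma_le_right) auto
        thus ?thesis
          using False by (simp add: D_def factor_const_def s_def mult_ac)
      qed
      thus ?thesis using True D s by (simp add: ennreal_leI flip: ennreal_mult')
    qed auto
  qed
  also have "\<dots> = ennreal (D * s) * (\<integral>\<^sup>+v. ennreal (exp (pi * \<bar>v\<bar> / 2)) * indicator {-U..U} v \<partial>lborel)"
    by (intro nn_integral_cmult) measurable
  also have "\<dots> \<le> ennreal (D * s) * ennreal (4 / pi * min 1 (pi * U) * exp (pi * U / 2))"
    by (intro mult_left_mono nn_integral_exp_abs_le U) auto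
  also have "\<dots> = ennreal (D * (s * min 1 (pi * U)) * (4 / pi) * exp (pi * U / 2))"
    using D s by (subst ennreal_mult'[symmetric]) (auto simp: mult_ac)
  also have "\<dots> \<le> ennreal (D * (5 * pi * (if \<gamma> < 1 then U powr (1 - \<gamma>) else 1)) * (4 / pi) * exp (pi * U / 2))"
  proof (intro ennreal_leI mult_right_mono mult_left_mono D)
    show "s * min 1 (pi * U) \<le> 5 * pi * (if \<gamma> < 1 then U powr (1 - \<gamma>) else 1)"
    proof (cases "\<gamma> < 1")
      case False
      thus ?thesis using pi_gt3 by (simp add: s_def)
    next
      case True
      have five: "5 powr ((1 - \<gamma>) / 2) \<le> (5::real)"
        using powr_mono[of "(1 - \<gamma>) / 2" 1 "5::real"] \<gamma> by simp
      show ?thesis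
      proof (cases "U \<ge> 1")
        case True
        have "(1 + 4 * U\<^sup>2) powr ((1 - \<gamma>) / 2) \<le> (5 * U\<^sup>2) powr ((1 - \<gamma>) / 2)"
          using True \<open>\<gamma> < 1\<close> by (intro powr_mono2) auto
        also have "\<dots> = 5 powr ((1 - \<gamma>) / 2) * U powr (1 - \<gamma>)"
        proof -
          have "(U\<^sup>2) powr ((1 - \<gamma>) / 2) = U powr (2 * ((1 - \<gamma>) / 2))"
            using U by (simp only: powr_powr flip: powr_numeral)
          also have "2 * ((1 - \<gamma>) / 2) = 1 - \<gamma>" by simp
          finally have "(U\<^sup>2) powr ((1 - \<gamma>) / 2) = U powr (1 - \<gamma>)" .
          thus ?thesis by (simp add: powr_mult)
        qed
        also have "\<dots> \<le> 5 * U powr (1 - \<gamma>)"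
          using five by (intro mult_right_mono) auto
        finally have "s \<le> 5 * U powr (1 - \<gamma>)" using \<open>\<gamma> < 1\<close> by (simp add: s_def)
        hence "s * min 1 (pi * U) \<le> 5 * U powr (1 - \<gamma>) * pi"
          using pi_gt3 s U by (intro mult_mono) auto
        thus ?thesis using \<open>\<gamma> < 1\<close> by (simp add: mult_ac)
      next
        case False
        hence "U\<^sup>2 \<le> 1" using U by (simp add: power_le_one)
        hence "(1 + 4 * U\<^sup>2) powr ((1 - \<gamma>) / 2) \<le> 5 powr ((1 - \<gamma>) / 2)"
          using \<open>\<gamma> < 1\<close> by (intro powr_mono2) auto
        also note five
        finally have "s \<le> 5" using \<open>\<gamma> < 1\<close> by (simp add: s_def)
        moreover have "U \<le> U powr (1 - \<gamma>)"
          using powr_mono'[of "1 - \<gamma>" 1 U] U False \<gamma> by simp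
        ultimately have "s * min 1 (pi * U) \<le> 5 * (pi * U powr (1 - \<gamma>))"
          using s U by (intro mult_mono) (auto intro: min.coboundedI2)
        thus ?thesis using \<open>\<gamma> < 1\<close> by simp
      qed
    qed
  qed auto
  \<comment> \<open>\<open>5 * pi * (4 / pi) = 20\<close>, whence the constant\<close>
  also have "D * (5 * pi * (if \<gamma> < 1 then U powr (1 - \<gamma>) else 1)) * (4 / pi) * exp (pi * U / 2) =
      20 * factor_const \<gamma> * (if \<gamma> < 1 then U powr (1 - \<gamma>) else 1) * exp (pi * U / 2)"
    by (simp add: D_def)
  finally show ?thesis .
qed

section \<open>Error of the estimator\<close>

lemma measurable_Complex [measurable]:
  assumes [measurable]: "f \<in> borel_measurable M" "g \<in> borel_measurable M"
  shows "(\<lambda>x. Complex (f x) (g x)) \<in> borel_measurable M"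
  unfolding Complex_eq by measurable

lemma continuous_on_Complex:
  "continuous_on A f \<Longrightarrow> continuous_on A g \<Longrightarrow> continuous_on A (\<lambda>x. Complex (f x) (g x))"
  unfolding Complex_eq by (intro continuous_intros)

lemma continuous_on_of_real_powr:
  assumes "continuous_on A f"
  shows "continuous_on A (\<lambda>v. complex_of_real \<bar>x\<bar> powr f v)"
proof (cases "x = 0")
  case False
  thus ?thesis using assms by (simp add: of_real_powr_complex_eq_exp continuous_intros)
qed simp

lemma continuous_on_empirical_mellin:
  assumes "continuous_on A f"
  shows "continuous_on A (\<lambda>v. empirical_mellin n xs (f v))"
  unfolding empirical_mellin_def using assms
  by (intro continuous_on_mult continuous_on_const continuous_on_sum continuous_on_of_real_powr continuous_on_diff)

lemma continuous_on_deconvolution_factor: "continuous_on A (deconvolution_factor \<gamma>)"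
proof -
  have "continuous_on A (\<lambda>v. rGamma (Complex (\<gamma> - 1/2) v) / complex_of_real \<bar>2\<bar> powr Complex \<gamma> v)"
    by (intro continuous_on_divide continuous_on_of_real_powr continuous_on_compose2[OF continuous_on_rGamma]
        continuous_on_Complex continuous_on_const continuous_on_id) auto
  thus ?thesis by (simp add: deconvolution_factor_def[abs_def])
qed

lemma measurable_deconvolution_factor [measurable]: "deconvolution_factor \<gamma> \<in> borel_measurable borel"
  by (intro borel_measurable_continuous_onI continuous_on_deconvolution_factor)

lemma estimator_eq:
  "estimator \<gamma> h n xs x = 1 / complex_of_real (sqrt pi) *
     (LINT v|lborel. complex_of_real x powr (- Complex \<gamma> v) * of_real (kernel (v * h)) *
        (empirical_mellin n xs (2 * Complex \<gamma> v - 1) * deconvolution_factor \<gamma> v))"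
proof -
  have "a / (b * inverse c) = a * (c / b)" for a b c :: complex by (simp add: divide_inverse)
  thus ?thesis unfolding estimator_def deconvolution_factor_def Gamma_def by (simp only:)
qed

lemma kernel_eq: "h > 0 \<Longrightarrow> kernel (v * h) = indicator {-(1/h)..1/h} v"
  by (auto simp: kernel_def indicator_def field_simps)

text \<open>
  The function \<open>m\<close> stands for the mean of the empirical transform. The hypothesis that relates it to
  \<open>\<M>\<close> turns the truncated inversion integral into the mean of the estimator, so that the error is the
  sum of the tail \<open>A\<close> and the centred part \<open>D\<close>.
\<close>
lemma estimator_error_le:
  fixes \<M> m :: "real \<Rightarrow> complex"
  assumes x: "x > 0" and h: "h > 0" and \<beta>: "\<beta> > 0"
    and inversion: "complex_of_real y = 1 / (2 * pi) * (LINT v|lborel. complex_of_real x powr (- Complex \<gamma> v) * \<M> v)"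
    and Mint: "integrable lborel \<M>"
    and tail: "(\<integral>\<^sup>+v. ennreal (cmod (\<M> v) * exp (\<beta> * \<bar>v\<bar>)) \<partial>lborel) \<le> ennreal L"
    and factor: "\<And>v. m v * deconvolution_factor \<gamma> v = \<M> v / (2 * sqrt pi)"
    and m_meas [measurable]: "m \<in> borel_measurable borel"
  shows "ennreal (x powr \<gamma> * cmod (of_real y - estimator \<gamma> h n xs x)) \<le>
    ennreal (L / (2 * pi) * exp (- \<beta> / h)) +
    ennreal (1 / sqrt pi) * (\<integral>\<^sup>+v. ennreal (indicator {-(1/h)..1/h} v * cmod (deconvolution_factor \<gamma> v)) *
        ennreal (cmod (empirical_mellin n xs (2 * Complex \<gamma> v - 1) - m v)) \<partial>lborel)"
proof -
  define U where "U = 1 / h"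
  have U: "U > 0" using h by (simp add: U_def)
  note kernel = kernel_eq[OF h, folded U_def]
  define E where "E v = empirical_mellin n xs (2 * Complex \<gamma> v - 1)" for v
  define q where "q = deconvolution_factor \<gamma>"
  define X where "X v = complex_of_real x powr (- Complex \<gamma> v)" for v
  have Xx: "X v = complex_of_real \<bar>x\<bar> powr (- Complex \<gamma> v)" for v using x by (simp add: X_def)
  have [measurable]: "X \<in> borel_measurable borel" unfolding Xx[abs_def] by measurable
  have X_norm: "cmod (X v) = x powr (- \<gamma>)" for v
    using x by (simp add: X_def norm_of_real_powr_complex)
  have X_cont: "continuous_on A X" for A
    unfolding Xx[abs_def] by (intro continuous_on_of_real_powr continuous_intros continuous_on_Complex)
  have [measurable]: "\<M> \<in> borel_measurable borel" using Mint by (simp add: borel_measurable_integrable)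
  have [measurable]: "q \<in> borel_measurable borel" unfolding q_def by measurable
  have E_cont: "continuous_on A E" for A
    unfolding E_def by (intro continuous_on_empirical_mellin continuous_intros continuous_on_Complex)
  have [measurable]: "E \<in> borel_measurable borel" by (intro borel_measurable_continuous_onI E_cont)
  define J where "J v = (indicator {-U..U} v :: real)" for v
  have [measurable]: "J \<in> borel_measurable borel" unfolding J_def by measurable
  have J01: "0 \<le> J v" "J v \<le> 1" for v by (auto simp: J_def indicator_def)

  have XM_int: "integrable lborel (\<lambda>v. X v * \<M> v)"
    by (rule Bochner_Integration.integrable_bound[where f = "\<lambda>v. x powr (- \<gamma>) * cmod (\<M> v)"])
       (use Mint in \<open>auto simp: norm_mult X_norm\<close>)
  have XEq_int: "integrable lborel (\<lambda>v. X v * of_real (J v) * (E v * q v))"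
  proof -
    have "integrable lborel (\<lambda>v. indicator {-U..U} v *\<^sub>R (X v * (E v * q v)))"
      unfolding q_def
      by (intro borel_integrable_compact continuous_intros X_cont E_cont continuous_on_deconvolution_factor) auto
    thus ?thesis by (simp add: J_def scaleR_conv_of_real mult_ac)
  qed
  have XM_J_int: "integrable lborel (\<lambda>v. X v * of_real (J v) * \<M> v)"
    by (rule Bochner_Integration.integrable_bound[OF XM_int])
       (auto simp: norm_mult J_def indicator_def)
  \<comment> \<open>\<open>A\<close> integrates to the bias, \<open>D\<close> to the stochastic part of the error\<close>
  define A where "A v = X v * of_real (1 - J v) * \<M> v / (2 * pi)" for v
  define D where "D v = X v * of_real (J v) * (q v * (m v - E v)) / sqrt pi" for v
  have sqrtpi: "complex_of_real (sqrt pi) * of_real (sqrt pi) = of_real pi" by (simp flip: of_real_mult)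
  have A_int: "integrable lborel A"
    unfolding A_def using XM_int XM_J_int
    by (simp add: algebra_simps diff_divide_distrib)
  have D_eq: "D v = X v * of_real (J v) * \<M> v / (2 * pi) - X v * of_real (J v) * (E v * q v) / sqrt pi" for v
  proof -
    have "D v = X v * of_real (J v) * (m v * q v) / sqrt pi - X v * of_real (J v) * (E v * q v) / sqrt pi"
      by (simp add: D_def algebra_simps diff_divide_distrib)
    also have "m v * q v = \<M> v / (2 * sqrt pi)" unfolding q_def by (rule factor)
    also have "X v * of_real (J v) * (\<M> v / (2 * sqrt pi)) / sqrt pi = X v * of_real (J v) * \<M> v / (2 * pi)"
      by (simp add: mult.assoc sqrtpi)
    finally show ?thesis .
  qed
  have D_int: "integrable lborel D"
    unfolding D_eq[abs_def] using XEq_int XM_J_int by (intro Bochner_Integration.integrable_diff integrable_divide_zero) auto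
  have "of_real y - estimator \<gamma> h n xs x =
      (LINT v|lborel. X v * \<M> v / (2 * pi)) - (LINT v|lborel. X v * of_real (J v) * (E v * q v) / sqrt pi)"
    unfolding inversion estimator_eq kernel X_def[symmetric] E_def[symmetric] q_def[symmetric] J_def[symmetric]
    by simp
  also have "\<dots> = (LINT v|lborel. X v * \<M> v / (2 * pi) - X v * of_real (J v) * (E v * q v) / sqrt pi)"
    using XM_int XEq_int by (intro Bochner_Integration.integral_diff[symmetric] integrable_divide_zero) auto
  also have "\<dots> = (LINT v|lborel. A v + D v)"
    by (intro Bochner_Integration.integral_cong refl)
       (simp add: D_eq A_def algebra_simps diff_divide_distrib add_divide_distrib)
  also have "\<dots> = (LINT v|lborel. A v) + (LINT v|lborel. D v)"
    by (intro Bochner_Integration.integral_add A_int D_int)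
  finally have "cmod (of_real y - estimator \<gamma> h n xs x) \<le> cmod (LINT v|lborel. A v) + cmod (LINT v|lborel. D v)"
    by (simp only: norm_triangle_ineq)
  hence "ennreal (x powr \<gamma> * cmod (of_real y - estimator \<gamma> h n xs x)) \<le>
      ennreal (x powr \<gamma>) * (ennreal (cmod (LINT v|lborel. A v)) + ennreal (cmod (LINT v|lborel. D v)))"
    by (subst ennreal_plus[symmetric], simp, simp, subst ennreal_mult'[symmetric], simp)
       (intro ennreal_leI mult_left_mono, auto)
  also have "\<dots> \<le> ennreal (x powr \<gamma>) * ((\<integral>\<^sup>+v. ennreal (cmod (A v)) \<partial>lborel) + (\<integral>\<^sup>+v. ennreal (cmod (D v)) \<partial>lborel))"
    using integral_norm_bound_ennreal[OF A_int] integral_norm_bound_ennreal[OF D_int]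
    by (intro mult_left_mono add_mono) auto
  also have "\<dots> = (\<integral>\<^sup>+v. ennreal (x powr \<gamma>) * ennreal (cmod (A v)) \<partial>lborel) +
      (\<integral>\<^sup>+v. ennreal (x powr \<gamma>) * ennreal (cmod (D v)) \<partial>lborel)"
    using A_int D_int by (subst (1 2) nn_integral_cmult) (auto simp: distrib_left)
  also have "\<dots> \<le> ennreal (L / (2 * pi) * exp (- \<beta> / h)) +
      ennreal (1 / sqrt pi) * (\<integral>\<^sup>+v. ennreal (J v * cmod (q v)) * ennreal (cmod (E v - m v)) \<partial>lborel)"
  proof (rule add_mono)
    have xx: "x powr \<gamma> * x powr (- \<gamma>) = 1" using x by (simp flip: powr_add)
    have "(\<integral>\<^sup>+v. ennreal (x powr \<gamma>) * ennreal (cmod (A v)) \<partial>lborel) \<le>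
        (\<integral>\<^sup>+v. ennreal (exp (- \<beta> / h) / (2 * pi)) * ennreal (cmod (\<M> v) * exp (\<beta> * \<bar>v\<bar>)) \<partial>lborel)"
    proof (rule nn_integral_mono)
      fix v :: real
      have "x powr \<gamma> * cmod (A v) = (x powr \<gamma> * x powr (- \<gamma>)) * ((1 - J v) * cmod (\<M> v) / (2 * pi))"
      proof -
        have "cmod (complex_of_real (1 - J v)) = 1 - J v" using J01[of v] by (simp only: norm_of_real)
        thus ?thesis by (simp only: A_def norm_mult norm_divide X_norm) simp
      qed
      also have "\<dots> = (1 - J v) * cmod (\<M> v) / (2 * pi)" by (simp only: xx mult_1)
      also have "\<dots> \<le> (exp (- \<beta> / h) * exp (\<beta> * \<bar>v\<bar>)) * cmod (\<M> v) / (2 * pi)"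
      proof (intro divide_right_mono mult_right_mono)
        show "1 - J v \<le> exp (- \<beta> / h) * exp (\<beta> * \<bar>v\<bar>)"
        proof (cases "v \<in> {-U..U}")
          case False
          hence "\<bar>v\<bar> \<ge> U" by auto
          hence "\<beta> * \<bar>v\<bar> \<ge> \<beta> * U" using \<beta> by (intro mult_left_mono) auto
          \<comment> \<open>beyond the cut-off the weight of the class pays for the factor \<open>exp (- \<beta> / h)\<close>\<close>
          hence "0 \<le> - \<beta> / h + \<beta> * \<bar>v\<bar>" by (simp add: U_def)
          hence "1 \<le> exp (- \<beta> / h + \<beta> * \<bar>v\<bar>)" by simp
          also have "\<dots> = exp (- \<beta> / h) * exp (\<beta> * \<bar>v\<bar>)" by (rule exp_add)
          finally show ?thesis using False by (simp add: J_def)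
        qed (simp add: J_def)
      qed auto
      finally have "x powr \<gamma> * cmod (A v) \<le> exp (- \<beta> / h) / (2 * pi) * (cmod (\<M> v) * exp (\<beta> * \<bar>v\<bar>))"
        by (simp add: mult_ac)
      thus "ennreal (x powr \<gamma>) * ennreal (cmod (A v)) \<le>
          ennreal (exp (- \<beta> / h) / (2 * pi)) * ennreal (cmod (\<M> v) * exp (\<beta> * \<bar>v\<bar>))"
        by (simp add: ennreal_leI flip: ennreal_mult')
    qed
    also have "\<dots> = ennreal (exp (- \<beta> / h) / (2 * pi)) * (\<integral>\<^sup>+v. ennreal (cmod (\<M> v) * exp (\<beta> * \<bar>v\<bar>)) \<partial>lborel)"
      by (rule nn_integral_cmult) measurable
    also have "\<dots> \<le> ennreal (exp (- \<beta> / h) / (2 * pi)) * ennreal L"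
      by (intro mult_left_mono tail) auto
    also have "\<dots> = ennreal (L / (2 * pi) * exp (- \<beta> / h))"
      by (subst ennreal_mult'[symmetric]) (auto simp: mult_ac)
    finally show "(\<integral>\<^sup>+v. ennreal (x powr \<gamma>) * ennreal (cmod (A v)) \<partial>lborel) \<le> ennreal (L / (2 * pi) * exp (- \<beta> / h))" .
    have "(\<integral>\<^sup>+v. ennreal (x powr \<gamma>) * ennreal (cmod (D v)) \<partial>lborel) =
      (\<integral>\<^sup>+v. ennreal (1 / sqrt pi) * (ennreal (J v * cmod (q v)) * ennreal (cmod (E v - m v))) \<partial>lborel)"
    proof (rule nn_integral_cong)
      fix v :: real
      have "x powr \<gamma> * cmod (D v) = (x powr \<gamma> * x powr (- \<gamma>)) * (J v * cmod (q v) * cmod (E v - m v) / sqrt pi)"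
        using J01[of v] by (simp add: D_def norm_mult norm_divide X_norm norm_minus_commute)
      also have "\<dots> = 1 / sqrt pi * (J v * cmod (q v) * cmod (E v - m v))" by (simp only: xx) simp
      finally show "ennreal (x powr \<gamma>) * ennreal (cmod (D v)) =
          ennreal (1 / sqrt pi) * (ennreal (J v * cmod (q v)) * ennreal (cmod (E v - m v)))"
        using J01[of v] by (simp flip: ennreal_mult')
    qed
    also have "\<dots> = ennreal (1 / sqrt pi) * (\<integral>\<^sup>+v. ennreal (J v * cmod (q v)) * ennreal (cmod (E v - m v)) \<partial>lborel)"
      by (rule nn_integral_cmult) measurable
    finally show "(\<integral>\<^sup>+v. ennreal (x powr \<gamma>) * ennreal (cmod (D v)) \<partial>lborel) \<le>
      ennreal (1 / sqrt pi) * (\<integral>\<^sup>+v. ennreal (J v * cmod (q v)) * ennreal (cmod (E v - m v)) \<partial>lborel)" by simp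
  qed
  finally show ?thesis unfolding J_def U_def q_def E_def .
qed

section \<open>The risk bound\<close>

definition variance_rate :: "real \<Rightarrow> real \<Rightarrow> real" where
  "variance_rate \<gamma> h = (if \<gamma> < 1 then h powr (2 * (\<gamma> - 1)) else 1) * exp (pi / h)"

definition risk_const :: "real \<Rightarrow> real \<Rightarrow> real \<Rightarrow> real" where
  "risk_const \<gamma> L m = max (2 * (L / (2 * pi))\<^sup>2)
     (2 / pi * (20 * factor_const \<gamma>)\<^sup>2 * (max m 0 * normal_abs_moment (4 * \<gamma> - 4)))"

lemma risk_const_nonneg: "risk_const \<gamma> L m \<ge> 0"
  by (simp add: risk_const_def le_max_iff_disj)

lemma ennreal_power2_add_le: "(a + b :: ennreal)\<^sup>2 \<le> 2 * a\<^sup>2 + 2 * b\<^sup>2"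
proof (cases a; cases b)
  fix x y :: real assume xy: "a = ennreal x" "0 \<le> x" "b = ennreal y" "0 \<le> y"
  have "(x + y)\<^sup>2 \<le> 2 * x\<^sup>2 + 2 * y\<^sup>2"
    using sum_squares_bound[of x y] by (simp add: power2_sum)
  hence "ennreal ((x + y)\<^sup>2) \<le> ennreal (2 * x\<^sup>2 + 2 * y\<^sup>2)" by (rule ennreal_leI)
  moreover have "(a + b)\<^sup>2 = ennreal ((x + y)\<^sup>2)"
    using xy by (simp add: ennreal_power flip: ennreal_plus)
  moreover have "ennreal (2 * x\<^sup>2 + 2 * y\<^sup>2) = 2 * a\<^sup>2 + 2 * b\<^sup>2"
    using xy by (simp add: ennreal_mult' ennreal_power)
  ultimately show ?thesis by (simp only:)
qed (auto simp: ennreal_mult_eq_top_iff power2_eq_square)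

lemma measurable_mellin [measurable]:
  assumes [measurable]: "p \<in> borel_measurable borel"
  shows "(\<lambda>v. mellin p (Complex \<gamma> v)) \<in> borel_measurable borel"
proof -
  have "mellin p (Complex \<gamma> v) =
      (LINT x|lborel. indicator {0<..} x *\<^sub>R (of_real (p x) * complex_of_real \<bar>x\<bar> powr (Complex \<gamma> v - 1)))" for v
    unfolding mellin_def set_lebesgue_integral_def
    by (intro Bochner_Integration.integral_cong refl) (auto simp: indicator_def)
  thus ?thesis by simp
qed

text \<open>
  Otherwise the non-negative variable would be zero almost surely, although a law with a density has
  no atom at zero.
\<close>
lemma density_of_nonneg_not_AE_zero:
  fixes T :: "'a \<Rightarrow> real"
  assumes M: "prob_space M" and dist: "distributed M lborel T (\<lambda>x. ennreal (p x))"
    and p: "\<And>x. p x \<ge> 0" and T: "\<And>\<omega>. \<omega> \<in> space M \<Longrightarrow> T \<omega> \<ge> 0"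
  shows "\<not> (AE x in lborel. x > 0 \<longrightarrow> p x = 0)"
proof
  assume zero: "AE x in lborel. x > 0 \<longrightarrow> p x = 0"
  interpret prob_space M by fact
  have "emeasure M (space M) = emeasure M (T -` {0::real..} \<inter> space M)"
    using T by (intro arg_cong[where f = "emeasure M"]) auto
  also have "\<dots> = (\<integral>\<^sup>+x. ennreal (p x) * indicator {0::real..} x \<partial>lborel)"
    by (rule distributed_emeasure[OF dist]) simp
  also have "\<dots> = (\<integral>\<^sup>+x. 0 \<partial>(lborel :: real measure))"
  proof (rule nn_integral_cong_AE)
    have "AE x in lborel. x \<noteq> (0::real)" by (rule AE_lborel_singleton)
    with zero show "AE x in lborel. ennreal (p x) * indicator {0..} x = 0"
      by eventually_elim (auto simp: indicator_def)
  qed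
  finally show False by (simp add: emeasure_space_1)
qed

text \<open>
  Both the squared bias and the second moment of the stochastic part enter with a factor two, from
  \<open>(a + b)\<^sup>2 \<le> 2 * a\<^sup>2 + 2 * b\<^sup>2\<close>.
\<close>
lemma weighted_risk_le:
  assumes bm: "brownian_motion M B" and T: "\<And>\<omega>. \<omega> \<in> space M \<Longrightarrow> 0 \<le> T \<omega>"
    and ind: "indep_time_process M T B" and p: "\<And>x. 0 \<le> p x"
    and dist: "distributed M lborel T (\<lambda>x. ennreal (p x))" and cont: "continuous_on {0<..} p"
    and \<beta>: "\<beta> > 0" and cls: "p \<in> mellin_class \<beta> \<gamma> L" and \<gamma>: "\<gamma> > 3/4"
    and mom: "(\<integral>\<^sup>+\<omega>. ennreal (T \<omega> powr (2 * \<gamma> - 2)) \<partial>M) \<le> ennreal m"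
    and h: "h > 0" and n: "n \<ge> 1" and iid: "iid_copies P X {1..n} M (\<lambda>\<omega>. B (T \<omega>) \<omega>)"
    and x: "x \<ge> 0"
  shows "weighted_risk P X n h \<gamma> p x \<le>
    ennreal (risk_const \<gamma> L m * (exp (- 2 * \<beta> / h) + 1 / real n * variance_rate \<gamma> h))"
proof (cases "x = 0")
  case True
  thus ?thesis by (simp add: weighted_risk_def)
next
  case False
  hence x: "x > 0" using x by simp
  interpret M: prob_space M using bm by (simp add: brownian_motion_def)
  interpret P: prob_space P using iid by (simp add: iid_copies_def)
  have T_meas [measurable]: "T \<in> borel_measurable M"
    using distributed_measurable[OF dist] by simp
  have p_meas [measurable]: "p \<in> borel_measurable borel"
    using distributed_real_measurable[OF _ dist] p by simp
  define \<mu> where "\<mu> = distr (M \<Otimes>\<^sub>M std_normal_distribution) borel (\<lambda>(\<omega>, x). sqrt (T \<omega>) * x)"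
  have "distr M borel (\<lambda>\<omega>. B (T \<omega>) \<omega>) = \<mu>"
    unfolding \<mu>_def by (rule distr_brownian_random_time[OF bm T ind T_meas])
  hence law: "distr P borel (X k) = \<mu>" if "k \<in> {1..n}" for k
    using iid that unfolding iid_copies_def by simp
  have indX: "P.indep_vars (\<lambda>_. borel) X {1..n}" using iid by (simp add: iid_copies_def)
  have X [measurable]: "X k \<in> borel_measurable P" if "k \<in> {1..n}" for k
    using indX that unfolding P.indep_vars_def by auto

  define \<M> where "\<M> v = mellin p (Complex \<gamma> v)" for v
  have [measurable]: "\<M> \<in> borel_measurable borel" unfolding \<M>_def by measurable
  have sint: "set_integrable lborel {0<..} (\<lambda>x. complex_of_real (p x) * complex_of_real x powr (Complex \<gamma> v - 1))" for v
    using cls by (simp add: mellin_class_def)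
  have tail: "(\<integral>\<^sup>+v. ennreal (cmod (\<M> v) * exp (\<beta> * \<bar>v\<bar>)) \<partial>lborel) < ennreal L"
    using cls by (simp add: mellin_class_def \<M>_def)
  have Mint: "integrable lborel \<M>"
  proof (rule integrableI_bounded)
    have "(\<integral>\<^sup>+v. ennreal (norm (\<M> v)) \<partial>lborel) \<le> (\<integral>\<^sup>+v. ennreal (cmod (\<M> v) * exp (\<beta> * \<bar>v\<bar>)) \<partial>lborel)"
      using \<beta> by (intro nn_integral_mono ennreal_leI) (simp add: mult_le_cancel_left1)
    also note tail
    finally show "(\<integral>\<^sup>+v. ennreal (norm (\<M> v)) \<partial>lborel) < \<infinity>"
      by (rule order.strict_trans) simp
  qed measurable
  have inversion: "complex_of_real (p x) =
      1 / (2 * pi) * (LINT v|lborel. complex_of_real x powr (- Complex \<gamma> v) * \<M> v)"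
    unfolding \<M>_def
    by (rule mellin_inversion[OF p_meas p cont density_of_nonneg_not_AE_zero[OF M.prob_space_axioms dist p T] sint])
       (use Mint x in \<open>auto simp: \<M>_def[abs_def]\<close>)

  define \<m> where "\<m> v = (LINT x|\<mu>. complex_of_real \<bar>x\<bar> powr ((2 * Complex \<gamma> v - 1) - 1))" for v
  have factor: "\<m> v * deconvolution_factor \<gamma> v = \<M> v / (2 * sqrt pi)" for v
  proof -
    define z where "z = Complex \<gamma> v"
    have z: "Re z > 1/2" "z - 1/2 = Complex (\<gamma> - 1/2) v" "2 * z - 1 - 1 = 2 * z - 2"
      using \<gamma> by (simp_all add: z_def complex_eq_iff)
    have "integrable M (\<lambda>\<omega>. complex_of_real (T \<omega>) powr (z - 1))"
      using mellin_eq_expectation(1)[OF dist p p_meas T, of z] sint[of v] by (simp add: z_def)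
    hence mv: "\<m> v = \<M> v * (2 powr (z - 1) * Gamma (z - 1/2) / of_real (sqrt pi))"
      using moment_normal_scale_mixture(2)[OF M.prob_space_axioms T_meas T z(1)]
        mellin_eq_expectation(2)[OF dist p p_meas T, of z]
      by (simp add: \<m>_def \<mu>_def \<M>_def z(3) z_def[symmetric])
    have "\<m> v * deconvolution_factor \<gamma> v =
        \<M> v * (2 powr (z - 1) / 2 powr z) * (Gamma (z - 1/2) * rGamma (z - 1/2)) / of_real (sqrt pi)"
    proof -
      have "A * (a * G / s) * (r / b) = A * (a / b) * (G * r) / s" for A a G s r b :: complex
        by (simp add: mult_ac)
      thus ?thesis
        unfolding mv deconvolution_factor_def z(2)[symmetric] z_def[symmetric] by this
    qed
    also have "(2::complex) powr (z - 1) / 2 powr z = 1 / 2"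
      by (simp add: powr_diff)
    also have "Gamma (z - 1/2) * rGamma (z - 1/2) = 1"
    proof -
      have "rGamma (z - 1/2) \<noteq> 0"
        using z(1) by (subst rGamma_eq_zero_iff) (auto elim!: nonpos_Ints_cases simp: complex_eq_iff)
      thus ?thesis by (simp add: Gamma_def)
    qed
    finally show ?thesis by simp
  qed
  interpret \<mu>: prob_space \<mu>
  proof -
    interpret N: real_distribution std_normal_distribution by (rule real_dist_normal_dist)
    interpret PP: pair_prob_space M std_normal_distribution ..
    show "prob_space \<mu>" unfolding \<mu>_def by (rule PP.prob_space_distr) measurable
  qed
  have [measurable_cong]: "sets \<mu> = sets borel" by (simp add: \<mu>_def)
  have m_meas [measurable]: "\<m> \<in> borel_measurable borel"
    unfolding \<m>_def by measurable

  define K where "K = max m 0 * normal_abs_moment (4 * \<gamma> - 4)"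
  have K: "K \<ge> 0" by (simp add: K_def normal_abs_moment_def)
  have "(\<integral>\<^sup>+\<omega>. ennreal (T \<omega> powr ((4 * \<gamma> - 4) / 2)) \<partial>M) \<le> ennreal m"
    using mom by (simp add: diff_divide_distrib)
  note abs_mom = abs_moment_normal_scale_mixture_le[OF M.prob_space_axioms T_meas T _ this, folded \<mu>_def K_def]
  \<comment> \<open>the exponent of the empirical transform at \<open>2 * z - 1\<close> doubles to \<open>4 * \<gamma> - 4\<close> in the variance\<close>
  have variance: "(\<integral>\<^sup>+\<omega>. (ennreal (cmod (empirical_mellin n (\<lambda>k. X k \<omega>) (2 * Complex \<gamma> v - 1) - \<m> v)))\<^sup>2 \<partial>P)
      \<le> ennreal (1 / real n * K)" for v
  proof -
    have r: "2 * Re (2 * Complex \<gamma> v - 1) - 2 = 4 * \<gamma> - 4" by simp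
    have "(\<integral>\<^sup>+\<omega>. ennreal ((cmod (empirical_mellin n (\<lambda>k. X k \<omega>) (2 * Complex \<gamma> v - 1) - \<m> v))\<^sup>2) \<partial>P)
        \<le> ennreal (1 / real n * (LINT x|\<mu>. \<bar>x\<bar> powr (4 * \<gamma> - 4)))"
      using empirical_mellin_variance_le[OF P.prob_space_axioms indX law n, of "2 * Complex \<gamma> v - 1"] abs_mom(1) \<gamma>
      unfolding \<m>_def r by simp
    also have "\<dots> \<le> ennreal (1 / real n * K)"
      using abs_mom(2) \<gamma> by (intro ennreal_leI mult_left_mono) auto
    finally show ?thesis by (simp add: ennreal_power)
  qed

  define U where "U = 1 / h"
  have U: "U > 0" using h by (simp add: U_def)
  define w where "w v = indicator {-U..U} v * cmod (deconvolution_factor \<gamma> v)" for v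
  define Y where "Y \<omega> v = ennreal (cmod (empirical_mellin n (\<lambda>k. X k \<omega>) (2 * Complex \<gamma> v - 1) - \<m> v))" for \<omega> v
  have w_meas [measurable]: "w \<in> borel_measurable lborel" unfolding w_def by measurable
  have Y_meas [measurable]: "case_prod Y \<in> borel_measurable (P \<Otimes>\<^sub>M lborel)"
    unfolding Y_def empirical_mellin_def by measurable
  define V where "V \<omega> = (\<integral>\<^sup>+v. ennreal (w v) * Y \<omega> v \<partial>lborel)" for \<omega>
  have V_meas [measurable]: "V \<in> borel_measurable P" unfolding V_def by measurable
  have rate: "(\<integral>\<^sup>+v. ennreal (w v) \<partial>lborel)\<^sup>2 \<le> ennreal ((20 * factor_const \<gamma>)\<^sup>2 * variance_rate \<gamma> h)"
  proof -
    define g where "g = (if \<gamma> < 1 then U powr (1 - \<gamma>) else 1)"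
    have g2: "g\<^sup>2 * exp (pi * U) = variance_rate \<gamma> h"
    proof (cases "\<gamma> < 1")
      case True
      have "(U powr (1 - \<gamma>))\<^sup>2 = h powr (2 * (\<gamma> - 1))"
        using h by (simp add: U_def powr_def ln_div exp_double[symmetric] algebra_simps)
      thus ?thesis using True by (simp add: g_def variance_rate_def U_def)
    qed (simp add: g_def variance_rate_def U_def)
    have nn: "20 * factor_const \<gamma> * g * exp (pi * U / 2) \<ge> 0"
      using \<gamma> by (simp add: factor_const_nonneg g_def)
    have "(\<integral>\<^sup>+v. ennreal (w v) \<partial>lborel) \<le> ennreal (20 * factor_const \<gamma> * g * exp (pi * U / 2))"
      unfolding w_def g_def using \<gamma> U by (intro nn_integral_deconvolution_factor_le) auto
    hence "(\<integral>\<^sup>+v. ennreal (w v) \<partial>lborel)\<^sup>2 \<le> (ennreal (20 * factor_const \<gamma> * g * exp (pi * U / 2)))\<^sup>2"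
      by (intro power_mono) auto
    also have "\<dots> = ennreal ((20 * factor_const \<gamma> * g * exp (pi * U / 2))\<^sup>2)"
      using nn by (simp add: ennreal_power)
    also have "(20 * factor_const \<gamma> * g * exp (pi * U / 2))\<^sup>2 = (20 * factor_const \<gamma>)\<^sup>2 * (g\<^sup>2 * exp (pi * U))"
      by (simp add: power_mult_distrib exp_double[symmetric])
    finally show ?thesis unfolding g2 .
  qed
  have vr: "variance_rate \<gamma> h \<ge> 0" by (simp add: variance_rate_def)
  have EV: "(\<integral>\<^sup>+\<omega>. (V \<omega>)\<^sup>2 \<partial>P) \<le> ennreal ((20 * factor_const \<gamma>)\<^sup>2 * variance_rate \<gamma> h * (1 / real n * K))"
  proof -
    have "(\<integral>\<^sup>+\<omega>. (V \<omega>)\<^sup>2 \<partial>P) \<le> (\<integral>\<^sup>+v. ennreal (w v) \<partial>lborel)\<^sup>2 * ennreal (1 / real n * K)"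
      unfolding V_def
    proof (rule nn_integral_weighted_power2_le[OF P.sigma_finite_measure_axioms
          lborel.sigma_finite_measure_axioms w_meas Y_meas])
      show "w v \<ge> 0" for v by (simp add: w_def)
      show "(\<integral>\<^sup>+\<omega>. (Y \<omega> v)\<^sup>2 \<partial>P) \<le> ennreal (1 / real n * K)" for v
        unfolding Y_def by (rule variance)
    qed
    also have "\<dots> \<le> ennreal ((20 * factor_const \<gamma>)\<^sup>2 * variance_rate \<gamma> h) * ennreal (1 / real n * K)"
      by (intro mult_right_mono rate) auto
    also have "\<dots> = ennreal ((20 * factor_const \<gamma>)\<^sup>2 * variance_rate \<gamma> h * (1 / real n * K))"
      using vr by (intro ennreal_mult'[symmetric]) simp
    finally show ?thesis .
  qed

  define b where "b = L / (2 * pi) * exp (- \<beta> / h)"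
  have L: "L > 0"
  proof (rule ccontr)
    assume "\<not> L > 0"
    hence "ennreal L = 0" by (simp add: ennreal_neg)
    thus False using tail by simp
  qed
  have b: "b \<ge> 0" using L by (simp add: b_def)
  have "weighted_risk P X n h \<gamma> p x \<le> (\<integral>\<^sup>+\<omega>. 2 * ennreal (b\<^sup>2) + ennreal (2 / pi) * (V \<omega>)\<^sup>2 \<partial>P)"
    unfolding weighted_risk_def
  proof (rule nn_integral_mono)
    fix \<omega>
    define e where "e = x powr \<gamma> * cmod (complex_of_real (p x) - estimator \<gamma> h n (\<lambda>k. X k \<omega>) x)"
    have "ennreal e \<le> ennreal b + ennreal (1 / sqrt pi) * V \<omega>"
      unfolding e_def b_def V_def w_def Y_def U_def
      by (rule estimator_error_le[OF x h \<beta> inversion Mint less_imp_le[OF tail] factor m_meas])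
    hence "(ennreal e)\<^sup>2 \<le> (ennreal b + ennreal (1 / sqrt pi) * V \<omega>)\<^sup>2"
      by (intro power_mono) auto
    also have "\<dots> \<le> 2 * (ennreal b)\<^sup>2 + 2 * (ennreal (1 / sqrt pi) * V \<omega>)\<^sup>2"
      by (rule ennreal_power2_add_le)
    also have "2 * (ennreal (1 / sqrt pi) * V \<omega>)\<^sup>2 = ennreal (2 / pi) * (V \<omega>)\<^sup>2"
    proof -
      have "2 * (ennreal (1 / sqrt pi))\<^sup>2 = ennreal (2 * (1 / sqrt pi)\<^sup>2)"
        by (simp add: ennreal_power ennreal_mult')
      also have "2 * (1 / sqrt pi)\<^sup>2 = 2 / pi" by (simp add: power_divide)
      finally show ?thesis by (simp add: power_mult_distrib mult.assoc[symmetric])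
    qed
    finally show "ennreal (e\<^sup>2) \<le> 2 * ennreal (b\<^sup>2) + ennreal (2 / pi) * (V \<omega>)\<^sup>2"
      using b by (simp add: ennreal_power e_def)
  qed
  also have "\<dots> = 2 * ennreal (b\<^sup>2) + ennreal (2 / pi) * (\<integral>\<^sup>+\<omega>. (V \<omega>)\<^sup>2 \<partial>P)"
    by (subst nn_integral_add) (auto simp: nn_integral_cmult P.emeasure_space_1)
  also have "\<dots> \<le> 2 * ennreal (b\<^sup>2) +
      ennreal (2 / pi) * ennreal ((20 * factor_const \<gamma>)\<^sup>2 * variance_rate \<gamma> h * (1 / real n * K))"
    by (intro add_left_mono mult_left_mono EV) auto
  also have "\<dots> = ennreal (2 * b\<^sup>2 + 2 / pi * ((20 * factor_const \<gamma>)\<^sup>2 * variance_rate \<gamma> h * (1 / real n * K)))"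
  proof -
    have "ennreal (2 * b\<^sup>2) = 2 * ennreal (b\<^sup>2)" by (simp add: ennreal_mult')
    moreover have "ennreal (2 / pi * Q) = ennreal (2 / pi) * ennreal Q" for Q
      by (rule ennreal_mult') simp
    ultimately show ?thesis using vr K by (subst ennreal_plus) (auto simp only:, auto)
  qed
  also have "\<dots> \<le> ennreal (risk_const \<gamma> L m * (exp (- 2 * \<beta> / h) + 1 / real n * variance_rate \<gamma> h))"
  proof (rule ennreal_leI)
    have "2 * b\<^sup>2 = 2 * (L / (2 * pi))\<^sup>2 * exp (- 2 * \<beta> / h)"
    proof -
      have "b\<^sup>2 = (L / (2 * pi))\<^sup>2 * (exp (- \<beta> / h))\<^sup>2" unfolding b_def by (rule power_mult_distrib)
      thus ?thesis using exp_double[of "- \<beta> / h"] by simp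
    qed
    also have "\<dots> \<le> risk_const \<gamma> L m * exp (- 2 * \<beta> / h)"
      by (intro mult_right_mono) (auto simp: risk_const_def)
    finally have 1: "2 * b\<^sup>2 \<le> risk_const \<gamma> L m * exp (- 2 * \<beta> / h)" .
    have "2 / pi * ((20 * factor_const \<gamma>)\<^sup>2 * variance_rate \<gamma> h * (1 / real n * K)) =
        2 / pi * (20 * factor_const \<gamma>)\<^sup>2 * K * (1 / real n * variance_rate \<gamma> h)"
      by simp
    also have "\<dots> \<le> risk_const \<gamma> L m * (1 / real n * variance_rate \<gamma> h)"
      using vr by (intro mult_right_mono) (auto simp: risk_const_def K_def)
    finally show "2 * b\<^sup>2 + 2 / pi * ((20 * factor_const \<gamma>)\<^sup>2 * variance_rate \<gamma> h * (1 / real n * K)) \<le>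
        risk_const \<gamma> L m * (exp (- 2 * \<beta> / h) + 1 / real n * variance_rate \<gamma> h)"
      using 1 unfolding distrib_left by linarith
  qed
  finally show ?thesis .
qed

section \<open>The optimal bandwidth\<close>

lemma ennsqrt_le:
  assumes "r \<le> ennreal y" "y \<ge> 0"
  shows "ennsqrt r \<le> ennreal (sqrt y)"
proof -
  have "r < \<infinity>" using assms(1) by (rule order.strict_trans1) simp
  moreover have "enn2real r \<le> y" using assms enn2real_leI by blast
  ultimately show ?thesis by (auto simp: ennsqrt_def intro!: ennreal_leI)
qed

text \<open>
  With \<open>d\<close> the denominator of the bandwidth and \<open>s = pi + 2 * \<beta>\<close>, so \<open>h = s / d\<close>, the squared rate is
  exactly the bias term \<open>exp (- 2 * \<beta> * d / s)\<close>. The variance term is no larger: \<open>d / s \<le> ln n\<close> bounds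
  the power of \<open>h\<close>, and \<open>exp (- d + pi * d / s)\<close> equals the bias term by the choice of \<open>s\<close>. The bound
  \<open>d / s \<le> ln n\<close> also removes the dependence of the constant on \<open>\<beta>\<close>.
\<close>
lemma opt_bandwidth_rate:
  fixes \<gamma> \<beta> :: real
  assumes n: "n \<ge> 3" and \<beta>: "\<beta> > 0" and \<gamma>: "\<gamma> > 3/4"
  defines "h \<equiv> opt_bandwidth \<beta> \<gamma> n"
    and "r \<equiv> (if \<gamma> < 1 then real n powr (- \<beta> / (pi + 2 * \<beta>)) *
                    ln (real n) powr (2 * (1 - \<gamma>) * \<beta> / (pi + 2 * \<beta>))
               else real n powr (- \<beta> / (pi + 2 * \<beta>)))"
  shows "h > 0" and "r \<ge> 0" and "exp (- 2 * \<beta> / h) + 1 / real n * variance_rate \<gamma> h \<le> 2 * r\<^sup>2"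
proof -
  define l where "l = ln (real n)"
  define a where "a = (if \<gamma> < 1 then 1 - \<gamma> else 0)"
  define s where "s = pi + 2 * \<beta>"
  define d where "d = l - 2 * a * ln l"
  have a: "0 \<le> a" "a \<le> 1/4" using \<gamma> by (auto simp: a_def)
  have s: "s > 1" using \<beta> pi_gt3 by (simp add: s_def)
  \<comment> \<open>from \<open>n = 3\<close> on, \<open>ln n \<ge> 1\<close>, which makes the denominator \<open>d\<close> positive because \<open>2 * a \<le> 1/2\<close>\<close>
  have "exp (1::real) \<le> real n" using exp_le n by linarith
  hence l: "l \<ge> 1" unfolding l_def using n by (subst ln_ge_iff) auto
  have lnl: "0 \<le> ln l" "ln l \<le> l - 1" using l by (auto intro: ln_le_minus_one)
  have "2 * a * ln l \<le> 1/2 * (l - 1)" using a lnl by (intro mult_mono) auto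
  hence d: "d > 0" using l by (simp add: d_def)
  have d_le: "d \<le> l" using a lnl by (simp add: d_def)
  have h_eq: "h = s / d"
    by (simp add: h_def opt_bandwidth_def s_def d_def a_def l_def)
  show h: "h > 0" using s d by (simp add: h_eq)
  show "r \<ge> 0" by (simp add: r_def)
  have r: "r = exp (- \<beta> * d / s)"
  proof -
    have "real n powr (- \<beta> / s) = exp (- \<beta> / s * l)"
      using n by (simp add: powr_def l_def)
    moreover have "l powr (2 * a * \<beta> / s) = exp (2 * a * \<beta> / s * ln l)"
      using l by (simp add: powr_def)
    ultimately have "real n powr (- \<beta> / s) * l powr (2 * a * \<beta> / s) = exp (- \<beta> / s * l + 2 * a * \<beta> / s * ln l)"
      by (simp only: exp_add)
    also have "- \<beta> / s * l + 2 * a * \<beta> / s * ln l = - \<beta> * d / s"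
      using s by (simp add: d_def field_simps)
    also have "real n powr (- \<beta> / s) * l powr (2 * a * \<beta> / s) = r"
      using l by (simp add: r_def s_def l_def a_def)
    finally show ?thesis .
  qed
  have r2: "r\<^sup>2 = exp (- 2 * \<beta> * d / s)"
    using exp_double[of "- \<beta> * d / s"] by (simp add: r mult.assoc)
  have bias: "exp (- 2 * \<beta> / h) = r\<^sup>2" by (simp add: r2 h_eq)
  have "1 / real n * variance_rate \<gamma> h \<le> exp (- l) * (l powr (2 * a) * exp (pi * d / s))"
  proof -
    have "(if \<gamma> < 1 then h powr (2 * (\<gamma> - 1)) else 1) \<le> l powr (2 * a)"
    proof (cases "\<gamma> < 1")
      case True
      have "h powr (2 * (\<gamma> - 1)) = (d / s) powr (2 * a)"
        using s d True by (simp add: h_eq a_def powr_def ln_div algebra_simps)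
      also have "\<dots> \<le> l powr (2 * a)"
      proof (rule powr_mono2)
        have "d / s \<le> d" using s d by (simp add: divide_le_eq)
        thus "d / s \<le> l" using d_le by linarith
      qed (use a s d in auto)
      finally show ?thesis using True by simp
    qed (use l in \<open>simp add: a_def\<close>)
    moreover have "1 / real n = exp (- l)" using n by (simp add: l_def exp_minus inverse_eq_divide)
    ultimately show ?thesis
      unfolding variance_rate_def by (simp add: h_eq mult_left_mono mult_right_mono)
  qed
  also have "l powr (2 * a) = exp (2 * a * ln l)" using l by (simp add: powr_def)
  also have "exp (- l) * (exp (2 * a * ln l) * exp (pi * d / s)) = exp (- d + pi * d / s)"
    by (simp add: d_def flip: exp_add)
  also have "- d + pi * d / s = - 2 * \<beta> * d / s"
    using s by (simp add: s_def field_simps)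
  also have "exp (- 2 * \<beta> * d / s) = r\<^sup>2" by (simp only: r2)
  finally show "exp (- 2 * \<beta> / h) + 1 / real n * variance_rate \<gamma> h \<le> 2 * r\<^sup>2"
    using bias by simp
qed

theorem theorem2p2:
  fixes \<gamma> L m :: real
  assumes "L > 0"
  shows "\<exists>C C' :: real.
    \<forall>(M :: 'a measure) (B :: real \<Rightarrow> 'a \<Rightarrow> real) (T :: 'a \<Rightarrow> real) (p\<^sub>T :: real \<Rightarrow> real)
      (a\<^sub>T :: real) (b\<^sub>T :: ereal) (\<beta> :: real).
      brownian_motion M B \<and>
      (\<forall>\<omega>\<in>space M. 0 \<le> T \<omega>) \<and>
      indep_time_process M T B \<and>
      (\<forall>x. 0 \<le> p\<^sub>T x) \<and>
      distributed M lborel T (\<lambda>x. ennreal (p\<^sub>T x)) \<and>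
      continuous_on {0<..} p\<^sub>T \<and>
      0 \<le> a\<^sub>T \<and> a\<^sub>T < 1 \<and> 1 \<le> b\<^sub>T \<and>
      {z. a\<^sub>T < Re z \<and> ereal (Re z) < b\<^sub>T} \<subseteq> mellin_domain M T \<and>
      \<beta> > 0 \<and> p\<^sub>T \<in> mellin_class \<beta> \<gamma> L \<and>
      max ((a\<^sub>T + 1) / 2) (3 / 4) < \<gamma> \<and> ereal \<gamma> < b\<^sub>T \<and>
      (\<integral>\<^sup>+\<omega>. ennreal (T \<omega> powr (2 * \<gamma> - 2)) \<partial>M) \<le> ennreal m
      \<longrightarrow>
      (\<forall>h :: nat \<Rightarrow> real. (\<forall>n\<ge>1. h n > 0) \<and> h \<longlonglongrightarrow> 0 \<longrightarrow>
        (\<forall>n\<ge>1. \<forall>(P :: 'b measure) (X :: nat \<Rightarrow> 'b \<Rightarrow> real).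
          iid_copies P X {1..n} M (\<lambda>\<omega>. B (T \<omega>) \<omega>) \<longrightarrow>
          (SUP x\<in>{0..}. weighted_risk P X n (h n) \<gamma> p\<^sub>T x) \<le>
            ennreal (C *
              (if \<gamma> < 1
               then exp (- 2 * \<beta> / h n) + 1 / real n * h n powr (2 * (\<gamma> - 1)) * exp (pi / h n)
               else exp (- 2 * \<beta> / h n) + 1 / real n * exp (pi / h n))))) \<and>
      (\<forall>\<^sub>F n in sequentially. \<forall>(P :: 'b measure) (X :: nat \<Rightarrow> 'b \<Rightarrow> real).
          iid_copies P X {1..n} M (\<lambda>\<omega>. B (T \<omega>) \<omega>) \<longrightarrow>
          (SUP x\<in>{0..}. ennsqrt (weighted_risk P X n (opt_bandwidth \<beta> \<gamma> n) \<gamma> p\<^sub>T x)) \<le>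
            ennreal (C' *
              (if \<gamma> < 1
               then real n powr (- \<beta> / (pi + 2 * \<beta>)) *
                    ln (real n) powr (2 * (1 - \<gamma>) * \<beta> / (pi + 2 * \<beta>))
               else real n powr (- \<beta> / (pi + 2 * \<beta>)))))"
proof (rule exI[of _ "risk_const \<gamma> L m"], rule exI[of _ "sqrt (2 * risk_const \<gamma> L m)"],
    intro allI impI conjI, goal_cases)
  case (1 M B T p a b \<beta> h n P X)
  have "weighted_risk P X n (h n) \<gamma> p x \<le>
      ennreal (risk_const \<gamma> L m * (exp (- 2 * \<beta> / h n) + 1 / real n * variance_rate \<gamma> (h n)))"
    if "x \<in> {0..}" for x
    using 1 that by (intro weighted_risk_le[where M = M and B = B and T = T]) auto
  moreover have "exp (- 2 * \<beta> / h n) + 1 / real n * variance_rate \<gamma> (h n) =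
      (if \<gamma> < 1
       then exp (- 2 * \<beta> / h n) + 1 / real n * h n powr (2 * (\<gamma> - 1)) * exp (pi / h n)
       else exp (- 2 * \<beta> / h n) + 1 / real n * exp (pi / h n))"
    by (simp add: variance_rate_def)
  ultimately show ?case by (intro SUP_least) simp
next
  case (2 M B T p a b \<beta>)
  show ?case
  proof (rule eventually_sequentiallyI[of 3], intro allI impI SUP_least)
    fix n :: nat and P :: "'b measure" and X :: "nat \<Rightarrow> 'b \<Rightarrow> real" and x :: real
    assume n: "n \<ge> 3" and iid: "iid_copies P X {1..n} M (\<lambda>\<omega>. B (T \<omega>) \<omega>)" and x: "x \<in> {0..}"
    define h where "h = opt_bandwidth \<beta> \<gamma> n"
    define r where "r = (if \<gamma> < 1 then real n powr (- \<beta> / (pi + 2 * \<beta>)) *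
                    ln (real n) powr (2 * (1 - \<gamma>) * \<beta> / (pi + 2 * \<beta>))
               else real n powr (- \<beta> / (pi + 2 * \<beta>)))"
    have \<beta>\<gamma>: "\<beta> > 0" "\<gamma> > 3/4" using 2 by auto
    note rate = opt_bandwidth_rate[OF n \<beta>\<gamma>, folded h_def r_def]
    have "weighted_risk P X n h \<gamma> p x \<le>
        ennreal (risk_const \<gamma> L m * (exp (- 2 * \<beta> / h) + 1 / real n * variance_rate \<gamma> h))"
      using 2 n iid x rate(1) by (intro weighted_risk_le[where M = M and B = B and T = T]) auto
    also have "\<dots> \<le> ennreal (risk_const \<gamma> L m * (2 * r\<^sup>2))"
      by (intro ennreal_leI mult_left_mono rate risk_const_nonneg)
    finally have "ennsqrt (weighted_risk P X n h \<gamma> p x) \<le> ennreal (sqrt (risk_const \<gamma> L m * (2 * r\<^sup>2)))"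
      by (rule ennsqrt_le) (simp add: risk_const_nonneg)
    also have "sqrt (risk_const \<gamma> L m * (2 * r\<^sup>2)) = sqrt (2 * risk_const \<gamma> L m) * r"
      using rate(2) by (simp add: real_sqrt_mult)
    finally show "ennsqrt (weighted_risk P X n (opt_bandwidth \<beta> \<gamma> n) \<gamma> p x) \<le>
      ennreal (sqrt (2 * risk_const \<gamma> L m) *
              (if \<gamma> < 1
               then real n powr (- \<beta> / (pi + 2 * \<beta>)) *
                    ln (real n) powr (2 * (1 - \<gamma>) * \<beta> / (pi + 2 * \<beta>))
               else real n powr (- \<beta> / (pi + 2 * \<beta>))))"
      unfolding h_def r_def .
  qed
qed

end
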